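(* Assume the signal--entropy separation assumption and the mild-growth assumption on $K$ (stated in the context), and suppose in addition that $a,b=o(n)$, $a\gtrsim\log n$ and $K=O(1)$. Let $\hat\sigma_f$ be the $\varepsilon$-node-DP estimator defined in the context. There exist universal constants $L,c_{\mathrm{sig}},c_{\mathrm{priv}}>0$ such that, for all sufficiently large $n$, if $\varepsilon\ge L\log n$, then $$\sup_{\Theta(n,K,a,b,\beta)}\mathbb E\,r(\sigma_0,\hat\sigma_f)\le\exp\{-c_{\mathrm{sig}}\,\mathrm{Signal}\}+\exp\{-c_{\mathrm{priv}}\,\varepsilon\}.$$
   Context: Graphs. $\mathcal G$ is the set of simple undirected graphs on $[n]=\{1,\dots,n\}$, identified with symmetric zero-diagonal matrices $A\in\{0,1\}^{n\times n}$. Write $A\sim_v A'$ (node-adjacent) if $A,A'$ differ only in the incident edges of a single vertex $v$. A randomized mechanism $M$ on $\mathcal G$ is $\varepsilon$-node-DP if $\mathbb P(M(A)\in S)\le e^{\varepsilon}\,\mathbb P(M(A')\in S)$ for all measurable $S$ and all $A\sim_v A'$. Model. $n\ge2$, $K\ge 2$, $\beta\ge 1$, and if $K\ge3$ also $1\le\beta<\sqrt{5/3}$. The parameters $K,a,b,\varepsilon$ may depend on $n$; asymptotic notation is as $n\to\infty$, and logarithms are natural. $\Sigma_\beta$ is the set of $\sigma:[n]\to[K]$ with $\frac{n}{\beta K}\le|\{i:\sigma(i)=k\}|\le\frac{\beta n}{K}$ for all $k\in[K]$. For $\sigma_0\in\Sigma_\beta$ and $n>a>b\ge 0$, $A\sim\mathrm{SBM}(\sigma_0)$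 means: the entries $A_{ij}$, $i<j$, are independent with $\mathbb P(A_{ij}=1)=a/n$ if $\sigma_0(i)=\sigma_0(j)$ and $b/n$ otherwise. $\Theta(n,K,a,b,\beta)$ is the family of these laws over $\sigma_0\in\Sigma_\beta$. Constant-SNR standing assumption: there are constants $0<\rho_-\le\rho_+<1$ with $\rho_-\le b/a\le\rho_+$ for all large $n$. "Universal" constants do not depend on $n$; the regime parameters $\rho_\pm$, $\beta$ and the implied constants in $K=O(1)$, $a\gtrsim\log n$ are regarded as fixed. $x\gtrsim y$ means $x\ge C'y$ for a constant $C'>0$. Loss. $r(\sigma,\hat\sigma):=\min_{\pi\in S_K}\frac1n\sum_{i=1}^n\mathbf 1\{\sigma(i)\ne\pi(\hat\sigma(i))\}$, with $S_K$ the permutations of $[K]$. Information. $I=-2\log\big(\sqrt{\tfrac an\tfrac bn}+\sqrt{(1-\tfrac an)(1-\tfrac bn)}\big)$; $\mathrm{Signal}:=nI/2$ if $K=2$ and $\mathrm{Signal}:=nI/(\beta K)$ if $K\ge3$. Score. $T_A(\sigma)=\sum_{i<j}(A_{ij}-\lambda)\mathbf 1\{\sigma(i)=\sigma(j)\}$, where $t^\star=\frac12\log\frac{a(1-b/n)}{b(1-a/n)}$ and $\lambda=-\frac{w}{t^\star}\log(\frac an e^{-t^\star}+1-\frac an)+\frac{1-w}{t^\star}\log(\frac bn e^{t^\star}+1-\frac bn)$, with $w=1/2$ if $K=2$ and any fixed $w\in[0,1]$ if $K\ge3$. Degree envelope. $\mathcal G_C:=\{A:\max_i\deg_A(i)\le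 C\max\{a,\log n\}\}$, where $C>0$ is a fixed constant, large enough that $\mathbb P(A\in\mathcal G_C)\ge1-\exp(-10(a+\log n))$ under the SBM for all $n$. $\Delta_a:=2C\max\{a,\log n\}$. Estimator. For $A\in\mathcal G_C$ and $\varepsilon_0:=\varepsilon/2$, the restricted Exponential Mechanism outputs $\sigma\in\Sigma_\beta$ with probability $\exp(\frac{\varepsilon_0}{2\Delta_a}T_A(\sigma))/\sum_{\tau\in\Sigma_\beta}\exp(\frac{\varepsilon_0}{2\Delta_a}T_A(\tau))$. The algorithm $\hat\sigma_f$ is an extension of it to all of $\mathcal G$: a mechanism $\mathcal G\to\Sigma_\beta$ that is $\varepsilon$-node-DP and whose output law at every $A\in\mathcal G_C$ equals that of the restricted mechanism (such an extension exists, by a known general extension lemma for differentially private mechanisms on metric spaces). Signal--entropy separation assumption: for a sufficiently large absolute constant $C_s>0$, $\mathrm{Signal}\ge C_s\log(nK)$ for all sufficiently large $n$. Mild-growth assumption: there is an absolute constant $C_{\mathrm{mg}}>0$ with $\log(nK)\ge C_{\mathrm{mg}}K\log K$ for all sufficiently large $n$. *)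

theory Defs
  imports "HOL-Probability.Probability" "HOL-Library.Landau_Symbols" "HOL-Combinatorics.Permutations"
begin

text \<open>A graph on \<open>{1..n}\<close> is its 0/1 adjacency matrix, with entries encoded as booleans and
  \<^term>\<open>False\<close> outside \<open>{1..n} \<times> {1..n}\<close>; a labelling is an extensional function
  \<open>{1..n} \<rightarrow> {1..K}\<close>.\<close>

type_synonym graph = "nat \<Rightarrow> nat \<Rightarrow> bool"
type_synonym labelling = "nat \<Rightarrow> nat"

definition graphs :: "nat \<Rightarrow> graph set" where
  "graphs n = {A. (\<forall>i j. A i j \<longrightarrow> i \<in> {1..n} \<and> j \<in> {1..n}) \<and>
                  (\<forall>i j. A i j = A j i) \<and> (\<forall>i. \<not> A i i)}"

definition node_adjacent :: "nat \<Rightarrow> graph \<Rightarrow> graph \<Rightarrow> bool" where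
  "node_adjacent n A A' \<longleftrightarrow>
     (\<exists>v\<in>{1..n}. \<forall>i j. i \<noteq> v \<and> j \<noteq> v \<longrightarrow> A i j = A' i j)"

text \<open>Outputs of mechanisms lie in a finite discrete space, so every set of outputs is measurable.\<close>

definition node_dp :: "nat \<Rightarrow> real \<Rightarrow> (graph \<Rightarrow> 'o pmf) \<Rightarrow> bool" where
  "node_dp n \<epsilon> M \<longleftrightarrow>
     (\<forall>A\<in>graphs n. \<forall>A'\<in>graphs n. node_adjacent n A A' \<longrightarrow>
        (\<forall>S. measure_pmf.prob (M A) S \<le> exp \<epsilon> * measure_pmf.prob (M A') S))"

definition Sigma_bal :: "nat \<Rightarrow> nat \<Rightarrow> real \<Rightarrow> labelling set" where
  "Sigma_bal n K \<beta> = {\<sigma> \<in> {1..n} \<rightarrow>\<^sub>E {1..K}. \<forall>k\<in>{1..K}.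
      real n / (\<beta> * real K) \<le> real (card {i\<in>{1..n}. \<sigma> i = k}) \<and>
      real (card {i\<in>{1..n}. \<sigma> i = k}) \<le> \<beta> * real n / real K}"

definition pairs :: "nat \<Rightarrow> (nat \<times> nat) set" where
  "pairs n = {(i, j). 1 \<le> i \<and> i < j \<and> j \<le> n}"

text \<open>The upper-triangular entries are independent Bernoulli variables and the matrix is
  completed symmetrically; the diagonal and the entries beyond \<open>n\<close> receive the default value
  \<^term>\<open>False\<close> of \<^const>\<open>Pi_pmf\<close>.\<close>

definition sbm :: "nat \<Rightarrow> real \<Rightarrow> real \<Rightarrow> labelling \<Rightarrow> graph pmf" where
  "sbm n a b \<sigma> =
     map_pmf (\<lambda>x i j. if i < j then x (i, j) else x (j, i))
       (Pi_pmf (pairs n) False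
          (\<lambda>(i, j). bernoulli_pmf (if \<sigma> i = \<sigma> j then a / real n else b / real n)))"

definition loss :: "nat \<Rightarrow> nat \<Rightarrow> labelling \<Rightarrow> labelling \<Rightarrow> real" where
  "loss n K \<sigma> \<sigma>' =
     Min ((\<lambda>\<pi>. 1 / real n * (\<Sum>i=1..n. of_bool (\<sigma> i \<noteq> \<pi> (\<sigma>' i)))) ` {\<pi>. \<pi> permutes {1..K}})"

definition info :: "nat \<Rightarrow> real \<Rightarrow> real \<Rightarrow> real" where
  "info n a b = - 2 * ln (sqrt (a / real n * (b / real n)) +
                          sqrt ((1 - a / real n) * (1 - b / real n)))"

definition signal :: "nat \<Rightarrow> nat \<Rightarrow> real \<Rightarrow> real \<Rightarrow> real \<Rightarrow> real" where
  "signal n K \<beta> a b =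
     (if K = 2 then real n * info n a b / 2 else real n * info n a b / (\<beta> * real K))"

definition tstar :: "nat \<Rightarrow> real \<Rightarrow> real \<Rightarrow> real" where
  "tstar n a b = 1 / 2 * ln (a * (1 - b / real n) / (b * (1 - a / real n)))"

definition penalty :: "nat \<Rightarrow> nat \<Rightarrow> real \<Rightarrow> real \<Rightarrow> real \<Rightarrow> real" where
  "penalty n K w a b =
     (let t = tstar n a b; w' = (if K = 2 then 1 / 2 else w) in
        - (w' / t) * ln (a / real n * exp (- t) + 1 - a / real n)
        + (1 - w') / t * ln (b / real n * exp t + 1 - b / real n))"

definition score :: "nat \<Rightarrow> nat \<Rightarrow> real \<Rightarrow> real \<Rightarrow> real \<Rightarrow> graph \<Rightarrow> labelling \<Rightarrow> real" where
  "score n K w a b A \<sigma> =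
     (\<Sum>(i, j)\<in>pairs n. (of_bool (A i j) - penalty n K w a b) * of_bool (\<sigma> i = \<sigma> j))"

definition deg :: "nat \<Rightarrow> graph \<Rightarrow> nat \<Rightarrow> nat" where
  "deg n A i = card {j\<in>{1..n}. A i j}"

definition envelope :: "nat \<Rightarrow> real \<Rightarrow> real \<Rightarrow> graph set" where
  "envelope n C a = {A \<in> graphs n. \<forall>i\<in>{1..n}. real (deg n A i) \<le> C * max a (ln (real n))}"

definition sensitivity :: "nat \<Rightarrow> real \<Rightarrow> real \<Rightarrow> real" where
  "sensitivity n C a = 2 * C * max a (ln (real n))"

definition exp_mech_prob ::
  "nat \<Rightarrow> nat \<Rightarrow> real \<Rightarrow> real \<Rightarrow> real \<Rightarrow> real \<Rightarrow> real \<Rightarrow> real \<Rightarrow> graph \<Rightarrow> labelling \<Rightarrow> real" where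
  "exp_mech_prob n K \<beta> w C a b \<epsilon>\<^sub>0 A \<sigma> =
     exp (\<epsilon>\<^sub>0 / (2 * sensitivity n C a) * score n K w a b A \<sigma>) /
     (\<Sum>\<tau>\<in>Sigma_bal n K \<beta>. exp (\<epsilon>\<^sub>0 / (2 * sensitivity n C a) * score n K w a b A \<tau>))"

text \<open>\<open>M\<close> is an \<open>\<epsilon>\<close>-node-DP mechanism on all graphs, extending the exponential mechanism run
  with budget \<open>\<epsilon> / 2\<close> on the degree envelope. Such an extension is not unique; results are stated
  for all of them. It can only exist if \<^const>\<open>Sigma_bal\<close> is nonempty.\<close>

definition private_estimator ::
  "nat \<Rightarrow> nat \<Rightarrow> real \<Rightarrow> real \<Rightarrow> real \<Rightarrow> real \<Rightarrow> real \<Rightarrow> real \<Rightarrow> (graph \<Rightarrow> labelling pmf) \<Rightarrow> bool" where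
  "private_estimator n K \<beta> w C a b \<epsilon> M \<longleftrightarrow>
     (\<forall>A\<in>graphs n. set_pmf (M A) \<subseteq> Sigma_bal n K \<beta>) \<and>
     node_dp n \<epsilon> M \<and>
     (\<forall>A\<in>envelope n C a. \<forall>\<sigma>\<in>Sigma_bal n K \<beta>.
        pmf (M A) \<sigma> = exp_mech_prob n K \<beta> w C a b (\<epsilon> / 2) A \<sigma>)"

text \<open>The expectation is over both the graph and the internal randomness of the mechanism.\<close>

definition risk ::
  "nat \<Rightarrow> nat \<Rightarrow> real \<Rightarrow> real \<Rightarrow> (graph \<Rightarrow> labelling pmf) \<Rightarrow> labelling \<Rightarrow> real" where
  "risk n K a b M \<sigma>\<^sub>0 =
     measure_pmf.expectation (bind_pmf (sbm n a b \<sigma>\<^sub>0) M) (loss n K \<sigma>\<^sub>0)"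

definition sbm_params :: "real \<Rightarrow> (nat \<Rightarrow> nat) \<Rightarrow> (nat \<Rightarrow> real) \<Rightarrow> (nat \<Rightarrow> real) \<Rightarrow> bool" where
  "sbm_params \<beta> K a b \<longleftrightarrow> \<beta> \<ge> 1 \<and>
     (\<forall>n\<ge>2. K n \<ge> 2 \<and> (K n \<ge> 3 \<longrightarrow> \<beta> < sqrt (5 / 3)) \<and>
            real n > a n \<and> a n > b n \<and> b n \<ge> 0)"

definition constant_snr :: "real \<Rightarrow> real \<Rightarrow> (nat \<Rightarrow> real) \<Rightarrow> (nat \<Rightarrow> real) \<Rightarrow> bool" where
  "constant_snr \<rho>\<^sub>m \<rho>\<^sub>p a b \<longleftrightarrow>
     (\<forall>\<^sub>F n in sequentially. \<rho>\<^sub>m \<le> b n / a n \<and> b n / a n \<le> \<rho>\<^sub>p)"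

definition envelope_whp ::
  "real \<Rightarrow> real \<Rightarrow> (nat \<Rightarrow> nat) \<Rightarrow> (nat \<Rightarrow> real) \<Rightarrow> (nat \<Rightarrow> real) \<Rightarrow> bool" where
  "envelope_whp C \<beta> K a b \<longleftrightarrow>
     (\<forall>n\<ge>2. \<forall>\<sigma>\<^sub>0\<in>Sigma_bal n (K n) \<beta>.
        measure_pmf.prob (sbm n (a n) (b n) \<sigma>\<^sub>0) (envelope n C (a n))
          \<ge> 1 - exp (- 10 * (a n + ln (real n))))"

definition signal_entropy_separation ::
  "real \<Rightarrow> real \<Rightarrow> (nat \<Rightarrow> nat) \<Rightarrow> (nat \<Rightarrow> real) \<Rightarrow> (nat \<Rightarrow> real) \<Rightarrow> bool" where
  "signal_entropy_separation C\<^sub>s \<beta> K a b \<longleftrightarrow>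
     (\<forall>\<^sub>F n in sequentially. signal n (K n) \<beta> (a n) (b n) \<ge> C\<^sub>s * ln (real n * real (K n)))"

definition mild_growth :: "(nat \<Rightarrow> nat) \<Rightarrow> bool" where
  "mild_growth K \<longleftrightarrow> (\<exists>C\<^sub>m\<^sub>g>0. \<forall>\<^sub>F n in sequentially.
     ln (real n * real (K n)) \<ge> C\<^sub>m\<^sub>g * real (K n) * ln (real (K n)))"

end

theory Submission imports Defs
begin

text \<open>On the degree envelope the mechanism outputs a labelling \<open>\<tau>\<close> with probability at most
  \<open>min 1 (exp (\<eta> * X))\<close>, where \<open>X\<close> is the score gain of \<open>\<tau>\<close> over the true labelling and \<open>\<eta>\<close> is of
  order \<open>\<epsilon> / a\<close>. The tilt \<open>tstar\<close> and the penalty are chosen so that every vertex pair on which the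
  two labellings disagree contributes a factor \<open>exp (- w * I)\<close> or \<open>exp (- (1 - w) * I)\<close> to
  \<open>E exp (tstar * X)\<close>; convexity carries this over to the smaller tilt \<open>min tstar \<eta>\<close>. A labelling
  with \<open>m\<close> mismatches disagrees with the truth on order \<open>m * n / K\<close> pairs, of either kind if \<open>K \<ge> 3\<close>,
  so its expected probability is at most \<open>exp (- m * Y)\<close> with \<open>Y\<close> at least a constant times the
  minimum of the signal and \<open>\<epsilon>\<close>. Both dominate \<open>ln (n * K)\<close>, which makes the union bound over all
  labellings converge.\<close>

section \<open>Exponential moments of the score difference\<close>

lemma bhattacharyya_pos:
  fixes p q :: real
  assumes "0 \<le> q" "q < p" "p < 1"
  shows "0 < sqrt (p * q) + sqrt ((1 - p) * (1 - q))"
  using assms by (intro add_nonneg_pos) auto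

text \<open>Here \<open>exp t\<close> is the square root of the odds ratio, which makes both
  transforms multiples of the Bhattacharyya coefficient \<open>B\<close>. The prefactors are
  reciprocal, so the product is \<open>B * B\<close>, the exponential of minus the
  information.\<close>

lemma bernoulli_mgf_at_tstar:
  fixes p q :: real
  assumes pq: "0 < q" "q < p" "p < 1"
    and t: "t = 1 / 2 * ln (p * (1 - q) / (q * (1 - p)))"
  defines "B \<equiv> sqrt (p * q) + sqrt ((1 - p) * (1 - q))"
  shows "p * exp (- t) + 1 - p = sqrt (1 - p) / sqrt (1 - q) * B"
    and "q * exp t + 1 - q = sqrt (1 - q) / sqrt (1 - p) * B"
proof -
  define P Q P' Q' where "P = sqrt p" and "Q = sqrt q" and "P' = sqrt (1 - p)" and "Q' = sqrt (1 - q)"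
  have pos: "P > 0" "Q > 0" "P' > 0" "Q' > 0"
    using pq by (auto simp: P_def Q_def P'_def Q'_def)
  have sq: "p = P * P" "q = Q * Q" "1 - p = P' * P'" "1 - q = Q' * Q'"
    using pq by (auto simp: P_def Q_def P'_def Q'_def)
  have B: "B = P * Q + P' * Q'"
    by (simp add: B_def P_def Q_def P'_def Q'_def real_sqrt_mult)
  have "exp t = sqrt (p * (1 - q) / (q * (1 - p)))"
    using pq by (simp add: t ln_sqrt[symmetric])
  also have "\<dots> = P * Q' / (Q * P')"
    by (simp add: P_def Q_def P'_def Q'_def real_sqrt_mult real_sqrt_divide)
  finally have et: "exp t = P * Q' / (Q * P')" .
  have emt: "exp (- t) = Q * P' / (P * Q')"
    using pos by (simp add: exp_minus et field_simps)
  have "p * exp (- t) + (1 - p) = P' / Q' * B"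
    unfolding emt B sq(3) unfolding sq(1) using pos by (simp add: field_simps)
  then show "p * exp (- t) + 1 - p = sqrt (1 - p) / sqrt (1 - q) * B"
    by (simp add: P'_def Q'_def)
  have "q * exp t + (1 - q) = Q' / P' * B"
    unfolding et B sq(4) unfolding sq(2) using pos by (simp add: field_simps)
  then show "q * exp t + 1 - q = sqrt (1 - q) / sqrt (1 - p) * B"
    by (simp add: P'_def Q'_def)
qed

text \<open>The weight that \<open>penalty\<close> actually uses. For two clusters the lower bound
  proved below concerns only the sum of the two broken-pair counts, which fits equal
  weights.\<close>

definition weight :: "nat \<Rightarrow> real \<Rightarrow> real" where
  "weight K w = (if K = 2 then 1 / 2 else w)"

text \<open>Taken in both orders of the labellings, these are exactly the pairs that only one of the
  two scores counts.\<close>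

definition broken_pairs :: "nat \<Rightarrow> labelling \<Rightarrow> labelling \<Rightarrow> (nat \<times> nat) set" where
  "broken_pairs n \<sigma> \<tau> = {(i, j) \<in> pairs n. \<sigma> i = \<sigma> j \<and> \<tau> i \<noteq> \<tau> j}"

lemma finite_pairs [simp]: "finite (pairs n)"
  by (rule finite_subset[of _ "{1..n} \<times> {1..n}"]) (auto simp: pairs_def)

lemma tstar_pos:
  assumes "0 < b" "b < a" "a < real n"
  shows "0 < tstar n a b"
proof -
  have "b / n < a / n" using assms by (intro divide_strict_right_mono) auto
  then have "b * (1 - a / n) < a * (1 - b / n)" "0 < 1 - a / n"
    using assms by (auto simp: field_simps)
  then have "1 < a * (1 - b / n) / (b * (1 - a / n))"
    using assms by simp
  then show ?thesis by (simp add: tstar_def)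
qed

text \<open>The penalty is designed so that \<open>t * \<kappa>\<close> is a combination of the two
  log transforms \<open>ln Ma\<close> and \<open>ln Mb\<close>. As these add up to minus the
  information, shifting either of them by \<open>t * \<kappa>\<close> leaves a fixed share of the
  information: \<open>1 - v\<close> for a pair inside a true cluster, \<open>v\<close> for a pair
  across clusters.\<close>

lemma tilted_bernoulli_mgf:
  fixes a b w :: real and n K :: nat
  assumes ab: "0 < b" "b < a" "a < real n"
  defines "t \<equiv> tstar n a b" and "\<kappa> \<equiv> penalty n K w a b"
  shows "a / n * exp (- t * (1 - \<kappa>)) + (1 - a / n) * exp (t * \<kappa>)
           = exp (- ((1 - weight K w) * info n a b))"
    and "b / n * exp (t * (1 - \<kappa>)) + (1 - b / n) * exp (- t * \<kappa>)
           = exp (- (weight K w * info n a b))"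
proof -
  define p q v where "p = a / n" and "q = b / n" and "v = weight K w"
  have pq: "0 < q" "q < p" "p < 1"
    using ab by (auto simp: p_def q_def divide_strict_right_mono)
  have t: "t = 1 / 2 * ln (p * (1 - q) / (q * (1 - p)))"
    using ab by (simp add: t_def tstar_def p_def q_def)
  have t0: "t > 0" unfolding t_def by (rule tstar_pos) (use ab in auto)
  define B where "B = sqrt (p * q) + sqrt ((1 - p) * (1 - q))"
  have B: "B > 0" unfolding B_def by (rule bhattacharyya_pos) (use pq in auto)
  define Ma Mb where "Ma = p * exp (- t) + 1 - p" and "Mb = q * exp t + 1 - q"
  have Ma: "Ma = sqrt (1 - p) / sqrt (1 - q) * B" and Mb: "Mb = sqrt (1 - q) / sqrt (1 - p) * B"
    unfolding Ma_def Mb_def B_def by (rule bernoulli_mgf_at_tstar[OF pq t])+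
  have pos: "Ma > 0" "Mb > 0" using B pq by (auto simp: Ma Mb)
  have "Ma * Mb = B * B" using pq by (simp add: Ma Mb field_simps)
  then have "ln (Ma * Mb) = ln (B * B)" by simp
  then have "ln Ma + ln Mb = 2 * ln B"
    using pos B by (simp add: ln_mult)
  moreover have I: "info n a b = - 2 * ln B"
    by (simp add: info_def B_def p_def q_def mult.commute)
  ultimately have lnM: "ln Ma + ln Mb = - info n a b" by simp
  have \<kappa>: "\<kappa> = - (v / t) * ln Ma + (1 - v) / t * ln Mb"
    by (simp add: \<kappa>_def penalty_def Let_def v_def weight_def Ma_def Mb_def p_def q_def t_def)
  have tl: "t * \<kappa> = - v * ln Ma + (1 - v) * ln Mb"
    unfolding \<kappa> using t0 by (simp add: distrib_left right_diff_distrib)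
  have "p * exp (- t * (1 - \<kappa>)) + (1 - p) * exp (t * \<kappa>) = exp (t * \<kappa>) * Ma"
    by (simp add: Ma_def algebra_simps flip: exp_add)
  also have "\<dots> = exp (t * \<kappa> + ln Ma)" using pos by (simp add: exp_add)
  also have "t * \<kappa> + ln Ma = (1 - v) * (ln Ma + ln Mb)" unfolding tl by (simp add: algebra_simps)
  finally show "a / n * exp (- t * (1 - \<kappa>)) + (1 - a / n) * exp (t * \<kappa>)
           = exp (- ((1 - weight K w) * info n a b))"
    by (simp add: lnM p_def v_def)
  have "q * exp (t * (1 - \<kappa>)) + (1 - q) * exp (- t * \<kappa>) = exp (- (t * \<kappa>)) * Mb"
    by (simp add: Mb_def algebra_simps flip: exp_add)
  also have "\<dots> = exp (- (t * \<kappa>) + ln Mb)" using pos by (simp only: exp_add exp_ln)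
  also have "- (t * \<kappa>) + ln Mb = v * (ln Ma + ln Mb)" unfolding tl by (simp add: algebra_simps)
  finally show "b / n * exp (t * (1 - \<kappa>)) + (1 - b / n) * exp (- t * \<kappa>)
           = exp (- (weight K w * info n a b))"
    by (simp add: lnM q_def v_def)
qed

text \<open>Independence of the entries turns the expectation into a product over pairs. A pair that
  both labellings join, or both separate, contributes 1; the others contribute the two factors of
  \<open>tilted_bernoulli_mgf\<close>.\<close>

lemma expectation_exp_score_diff:
  assumes ab: "0 < b" "b < a" "a < real n"
  shows "measure_pmf.expectation (sbm n a b \<sigma>)
           (\<lambda>A. exp (tstar n a b * (score n K w a b A \<tau> - score n K w a b A \<sigma>)))
         = exp (- (info n a b * (weight K w * card (broken_pairs n \<tau> \<sigma>)
                   + (1 - weight K w) * card (broken_pairs n \<sigma> \<tau>))))"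
proof -
  define t \<kappa> v I where "t = tstar n a b" and "\<kappa> = penalty n K w a b" and "v = weight K w"
    and "I = info n a b"
  define \<delta> :: "nat \<times> nat \<Rightarrow> real"
    where "\<delta> = (\<lambda>(i, j). of_bool (\<tau> i = \<tau> j) - of_bool (\<sigma> i = \<sigma> j))"
  define P where "P = (\<lambda>(i, j). bernoulli_pmf (if \<sigma> i = \<sigma> j then a / n else b / n))"
  define f where "f = (\<lambda>e x. exp (t * ((of_bool x - \<kappa>) * \<delta> e)))"
  \<comment> \<open>The symmetric completion from \<open>sbm\<close>; the score reads only entries
    with \<open>i < j\<close>, where it returns the independent variables themselves.\<close>
  define g where "g = (\<lambda>x (i::nat) (j::nat). if i < j then x (i, j) else x (j, i) :: bool)"
  have score_diff: "score n K w a b (g x) \<tau> - score n K w a b (g x) \<sigma>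
      = (\<Sum>e\<in>pairs n. (of_bool (x e) - \<kappa>) * \<delta> e)" for x
    unfolding score_def sum_subtractf[symmetric] \<kappa>_def \<delta>_def
    by (intro sum.cong) (auto simp: pairs_def g_def algebra_simps)
  have factor: "measure_pmf.expectation (P e) (f e)
      = (if e \<in> broken_pairs n \<sigma> \<tau> then exp (- (1 - v) * I) else 1)
      * (if e \<in> broken_pairs n \<tau> \<sigma> then exp (- v * I) else 1)" if "e \<in> pairs n" for e
  proof -
    obtain i j where e: "e = (i, j)" by force
    have "0 \<le> a / n" "a / n \<le> 1" "0 \<le> b / n" "b / n \<le> 1" using ab by auto
    then show ?thesis
      using that tilted_bernoulli_mgf[OF ab, of K w]
      by (auto simp: e P_def f_def \<delta>_def broken_pairs_def t_def \<kappa>_def v_def I_def algebra_simps)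
  qed
  have "measure_pmf.expectation (sbm n a b \<sigma>)
           (\<lambda>A. exp (tstar n a b * (score n K w a b A \<tau> - score n K w a b A \<sigma>)))
      = measure_pmf.expectation (Pi_pmf (pairs n) False P) (\<lambda>x. \<Prod>e\<in>pairs n. f e (x e))"
    unfolding sbm_def integral_map_pmf g_def[symmetric] P_def[symmetric] score_diff t_def[symmetric]
    by (simp add: f_def sum_distrib_left exp_sum)
  also have "\<dots> = (\<Prod>e\<in>pairs n. measure_pmf.expectation (P e) (f e))"
    by (rule expectation_prod_Pi_pmf)
       (auto simp: f_def P_def intro!: integrable_measure_pmf_finite)
  also have "\<dots> = (\<Prod>e\<in>pairs n. (if e \<in> broken_pairs n \<sigma> \<tau> then exp (- (1 - v) * I) else 1)
      * (if e \<in> broken_pairs n \<tau> \<sigma> then exp (- v * I) else 1))"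
    by (intro prod.cong factor refl)
  also have "\<dots> = exp (- (1 - v) * I) ^ card (broken_pairs n \<sigma> \<tau>)
      * exp (- v * I) ^ card (broken_pairs n \<tau> \<sigma>)"
  proof -
    have "pairs n \<inter> broken_pairs n x y = broken_pairs n x y" for x y
      by (auto simp: broken_pairs_def)
    then show ?thesis
      by (simp add: prod.distrib prod.If_cases flip: prod.inter_restrict)
  qed
  also have "\<dots> = exp (- (I * (v * card (broken_pairs n \<tau> \<sigma>) + (1 - v) * card (broken_pairs n \<sigma> \<tau>))))"
    by (simp flip: exp_of_nat_mult exp_add add: algebra_simps)
  finally show ?thesis by (simp add: v_def I_def)
qed

text \<open>The mechanism's likelihood ratio \<open>min 1 (exp (\<eta> X))\<close> is at most \<open>exp (\<theta> t X)\<close>; convexity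
  of \<open>exp\<close> between \<open>0\<close> and \<open>t X + J\<close> transfers the Chernoff bound from \<open>t\<close> to \<open>\<theta> t\<close>.\<close>

lemma expectation_min_exp_le:
  fixes X :: "'a \<Rightarrow> real"
  assumes int: "integrable (measure_pmf p) (\<lambda>x. exp (t * X x))"
    and mgf: "measure_pmf.expectation p (\<lambda>x. exp (t * X x)) = exp (- J)"
    and t: "0 < t" and eta: "0 \<le> \<eta>"
  shows "measure_pmf.expectation p (\<lambda>x. min 1 (exp (\<eta> * X x))) \<le> exp (- (min 1 (\<eta> / t) * J))"
proof -
  define \<theta> where "\<theta> = min 1 (\<eta> / t)"
  have \<theta>: "0 \<le> \<theta>" "\<theta> \<le> 1" "\<theta> * t \<le> \<eta>"
    using t eta by (auto simp: \<theta>_def min_def field_simps)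
  have pt: "min 1 (exp (\<eta> * X x)) \<le> exp (- (\<theta> * J)) * (1 - \<theta> + \<theta> * (exp J * exp (t * X x)))" for x
  proof -
    have "min 1 (exp (\<eta> * X x)) \<le> exp (\<theta> * t * X x)"
    proof (cases "0 \<le> X x")
      case True
      then show ?thesis using \<theta> t by (intro min.coboundedI1) simp
    next
      case False
      then show ?thesis using \<theta> by (intro min.coboundedI2) (simp add: mult_right_mono_neg)
    qed
    also have "\<dots> = exp (- (\<theta> * J)) * exp ((1 - \<theta>) * 0 + \<theta> * (J + t * X x))"
      by (simp flip: exp_add add: algebra_simps)
    also have "exp ((1 - \<theta>) * 0 + \<theta> * (J + t * X x)) \<le> (1 - \<theta>) * exp 0 + \<theta> * exp (J + t * X x)"
      using convex_onD[OF exp_convex, of \<theta> 0 "J + t * X x"] \<theta> by simp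
    finally show ?thesis by (simp add: exp_add)
  qed
  have "measure_pmf.expectation p (\<lambda>x. min 1 (exp (\<eta> * X x)))
      \<le> measure_pmf.expectation p (\<lambda>x. exp (- (\<theta> * J)) * (1 - \<theta> + \<theta> * (exp J * exp (t * X x))))"
    by (intro integral_mono pt integrable_mult_right Bochner_Integration.integrable_add int
          measure_pmf.integrable_const_bound[where B = 1]) (use \<theta> in auto)
  also have "\<dots> = exp (- (\<theta> * J)) * (1 - \<theta> + \<theta> * (exp J * exp (- J)))"
    using int by (simp add: mgf)
  also have "\<dots> = exp (- (\<theta> * J))" by (simp flip: exp_add)
  finally show ?thesis by (simp add: \<theta>_def)
qed

section \<open>Mismatches after relabelling versus broken pairs\<close>

text \<open>The complements of \<open>G\<close> and of its image have equal size, so any bijection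
  between them completes \<open>f\<close>. This turns a partial matching of clusters into a
  relabelling.\<close>

lemma permutes_extension:
  assumes "finite S" "inj_on f G" "G \<subseteq> S" "f ` G \<subseteq> S"
  obtains \<pi> where "\<pi> permutes S" "\<And>x. x \<in> G \<Longrightarrow> \<pi> x = f x"
proof -
  have fin: "finite G" "finite (f ` G)" using assms finite_subset by blast+
  have "card (S - G) = card (S - f ` G)"
    using assms fin by (simp add: card_Diff_subset card_image)
  then obtain h where h: "bij_betw h (S - G) (S - f ` G)"
    using assms(1) by (metis bij_betw_iff_card finite_Diff)
  define \<pi> where "\<pi> x = (if x \<in> G then f x else if x \<in> S then h x else x)" for x
  have "bij_betw \<pi> (G \<union> (S - G)) (f ` G \<union> (S - f ` G))"
  proof (rule bij_betw_combine)
    show "bij_betw \<pi> G (f ` G)"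
      using assms(2) by (intro bij_betw_imageI) (auto simp: \<pi>_def inj_on_def)
    show "bij_betw \<pi> (S - G) (S - f ` G)"
      using h by (rule bij_betw_cong[THEN iffD1, rotated]) (auto simp: \<pi>_def)
  qed auto
  then have "bij_betw \<pi> S S" using assms(3,4) by (simp add: Un_absorb1)
  moreover have "\<pi> x = x" if "x \<notin> S" for x using that assms(3) by (auto simp: \<pi>_def)
  ultimately have "\<pi> permutes S" by (rule bij_imp_permutes)
  then show thesis by (rule that) (simp add: \<pi>_def)
qed

definition mismatches :: "nat \<Rightarrow> (nat \<Rightarrow> nat) \<Rightarrow> labelling \<Rightarrow> labelling \<Rightarrow> nat" where
  "mismatches n \<pi> \<sigma> \<tau> = card {i \<in> {1..n}. \<sigma> i \<noteq> \<pi> (\<tau> i)}"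

text \<open>The left side counts ordered pairs. The diagonal is excluded by the second condition, so
  they split into the broken pairs and their mirror images.\<close>

lemma sum_vertex_broken_pairs:
  "(\<Sum>i\<in>{1..n}. card {j \<in> {1..n}. \<sigma> i = \<sigma> j \<and> \<tau> i \<noteq> \<tau> j}) = 2 * card (broken_pairs n \<sigma> \<tau>)"
proof -
  define D where "D = (SIGMA i:{1..n}. {j \<in> {1..n}. \<sigma> i = \<sigma> j \<and> \<tau> i \<noteq> \<tau> j})"
  have fin: "finite (broken_pairs n \<sigma> \<tau>)"
    by (rule finite_subset[OF _ finite_pairs]) (auto simp: broken_pairs_def)
  have "D = broken_pairs n \<sigma> \<tau> \<union> prod.swap ` broken_pairs n \<sigma> \<tau>" (is "_ = ?U")
  proof (intro set_eqI iffI)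
    fix x assume x: "x \<in> D"
    obtain i j where ij: "x = (i, j)" by force
    with x have "i < j \<or> j < i" unfolding D_def by (cases i j rule: linorder_cases) auto
    then show "x \<in> ?U"
      using x unfolding ij Un_iff pair_in_swap_image by (auto simp: D_def broken_pairs_def pairs_def)
  qed (auto simp: D_def broken_pairs_def pairs_def)
  moreover have "broken_pairs n \<sigma> \<tau> \<inter> prod.swap ` broken_pairs n \<sigma> \<tau> = {}"
    by (auto simp: broken_pairs_def pairs_def)
  ultimately have "card D = 2 * card (broken_pairs n \<sigma> \<tau>)"
    using fin by (simp add: card_Un_disjoint card_image)
  then show ?thesis by (simp add: D_def)
qed

text \<open>With two labels, a pair is broken in one of the two directions iff the labellings differ
  at exactly one of its endpoints. Each vertex of \<open>D\<close> is thus paired with all of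
  \<open>E\<close>, and conversely.\<close>

lemma card_broken_pairs_two_clusters:
  assumes "\<sigma> \<in> {1..n} \<rightarrow>\<^sub>E {1..2}" "\<tau> \<in> {1..n} \<rightarrow>\<^sub>E {1..2}"
  defines "d \<equiv> card {i \<in> {1..n}. \<sigma> i \<noteq> \<tau> i}"
  shows "card (broken_pairs n \<sigma> \<tau>) + card (broken_pairs n \<tau> \<sigma>) = d * (n - d)"
proof -
  define D where "D = {i \<in> {1..n}. \<sigma> i \<noteq> \<tau> i}"
  define E where "E = {i \<in> {1..n}. \<sigma> i = \<tau> i}"
  have two: "x i = 1 \<or> x i = 2" if "i \<in> {1..n}" "x \<in> {1..n} \<rightarrow>\<^sub>E {1..2}" for i and x :: labelling
    using PiE_mem[OF that(2,1)] by auto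
  have DE: "D \<union> E = {1..n}" "D \<inter> E = {}" "finite D" "finite E" by (auto simp: D_def E_def)
  then have "n = card D + card E"
    using card_Un_disjoint[of D E] by simp
  then have cE: "card E = n - d" unfolding d_def D_def[symmetric] by simp
  have nb: "{j \<in> {1..n}. \<sigma> i = \<sigma> j \<and> \<tau> i \<noteq> \<tau> j} \<union> {j \<in> {1..n}. \<tau> i = \<tau> j \<and> \<sigma> i \<noteq> \<sigma> j}
      = (if i \<in> D then E else D)" if i: "i \<in> {1..n}" for i
  proof (intro set_eqI)
    fix j
    show "j \<in> {j \<in> {1..n}. \<sigma> i = \<sigma> j \<and> \<tau> i \<noteq> \<tau> j} \<union> {j \<in> {1..n}. \<tau> i = \<tau> j \<and> \<sigma> i \<noteq> \<sigma> j}
        \<longleftrightarrow> j \<in> (if i \<in> D then E else D)"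
    proof (cases "j \<in> {1..n}")
      case True
      then show ?thesis
        using two[OF i assms(1)] two[OF i assms(2)] two[OF True assms(1)] two[OF True assms(2)] i
        by (elim disjE) (simp_all add: D_def E_def)
    qed (auto simp: D_def E_def)
  qed
  have "2 * (card (broken_pairs n \<sigma> \<tau>) + card (broken_pairs n \<tau> \<sigma>))
      = (\<Sum>i\<in>{1..n}. card ({j \<in> {1..n}. \<sigma> i = \<sigma> j \<and> \<tau> i \<noteq> \<tau> j} \<union> {j \<in> {1..n}. \<tau> i = \<tau> j \<and> \<sigma> i \<noteq> \<sigma> j}))"
    unfolding distrib_left sum_vertex_broken_pairs[symmetric] sum.distrib[symmetric]
    by (intro sum.cong refl card_Un_disjoint[symmetric]) auto
  also have "\<dots> = (\<Sum>i\<in>D \<union> E. card (if i \<in> D then E else D))"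
    unfolding DE(1) by (intro sum.cong refl arg_cong[where f = card] nb)
  also have "\<dots> = (\<Sum>i\<in>D. card E) + (\<Sum>i\<in>E. card D)"
  proof -
    have "(\<Sum>i\<in>E. card (if i \<in> D then E else D)) = (\<Sum>i\<in>E. card D)"
      using DE(2) by (intro sum.cong) auto
    then show ?thesis using DE by (subst sum.union_disjoint) simp_all
  qed
  also have "\<dots> = 2 * (d * (n - d))" using cE unfolding d_def D_def[symmetric] by simp
  finally show ?thesis by simp
qed

text \<open>The identity has \<open>d\<close> mismatches and the swap \<open>n - d\<close>. The
  smaller of the two numbers is used, and the other factor of \<open>d * (n - d)\<close> is then at
  least \<open>n / 2\<close>.\<close>

lemma exists_mismatches_le_broken_pairs_two_clusters:
  assumes "\<sigma> \<in> {1..n} \<rightarrow>\<^sub>E {1..2}" "\<tau> \<in> {1..n} \<rightarrow>\<^sub>E {1..2}"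
  shows "\<exists>\<pi>. \<pi> permutes {1..2} \<and>
    n * mismatches n \<pi> \<sigma> \<tau> \<le> 2 * (card (broken_pairs n \<sigma> \<tau>) + card (broken_pairs n \<tau> \<sigma>))"
proof -
  define d where "d = card {i \<in> {1..n}. \<sigma> i \<noteq> \<tau> i}"
  have bp: "card (broken_pairs n \<sigma> \<tau>) + card (broken_pairs n \<tau> \<sigma>) = d * (n - d)"
    unfolding d_def by (rule card_broken_pairs_two_clusters[OF assms])
  have "d \<le> card {1..n}" unfolding d_def by (rule card_mono) auto
  then have dn: "d \<le> n" by simp
  have two: "x i = 1 \<or> x i = 2" if "i \<in> {1..n}" "x \<in> {1..n} \<rightarrow>\<^sub>E {1..2}" for i and x :: labelling
    using PiE_mem[OF that(2,1)] by auto
  show ?thesis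
  proof (cases "2 * d \<le> n")
    case True
    have "n * d \<le> 2 * (d * (n - d))"
    proof -
      have "d * n \<le> d * (2 * (n - d))" using True by (intro mult_le_mono2) auto
      then show ?thesis by (simp add: mult_ac)
    qed
    then show ?thesis unfolding bp
      by (intro exI[of _ id] conjI permutes_id) (simp add: mismatches_def d_def)
  next
    case False
    define \<pi> where "\<pi> = Transposition.transpose (1::nat) 2"
    have eq: "{i \<in> {1..n}. \<sigma> i \<noteq> \<pi> (\<tau> i)} = {1..n} - {i \<in> {1..n}. \<sigma> i \<noteq> \<tau> i}"
    proof (intro set_eqI)
      fix i
      show "i \<in> {i \<in> {1..n}. \<sigma> i \<noteq> \<pi> (\<tau> i)} \<longleftrightarrow> i \<in> {1..n} - {i \<in> {1..n}. \<sigma> i \<noteq> \<tau> i}"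
      proof (cases "i \<in> {1..n}")
        case True
        then show ?thesis
          using two[OF True assms(1)] two[OF True assms(2)]
          by (elim disjE) (simp_all add: \<pi>_def Transposition.transpose_def)
      qed auto
    qed
    have "mismatches n \<pi> \<sigma> \<tau> = card {1..n} - d"
      unfolding mismatches_def d_def eq by (rule card_Diff_subset) auto
    then have "mismatches n \<pi> \<sigma> \<tau> = n - d" by simp
    moreover have "n * (n - d) \<le> 2 * (d * (n - d))"
      using False by (simp flip: mult.assoc)
    ultimately show ?thesis unfolding bp
      by (intro exI[of _ \<pi>] conjI) (auto simp: \<pi>_def intro!: permutes_swap_id)
  qed
qed

text \<open>Let \<open>e k\<close> be the number of vertices of cluster \<open>k\<close> of \<open>\<sigma>\<close> outside its largest
  intersection with a cluster of \<open>\<tau>\<close>. Clusters with an intersection of more than half the maximal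
  cluster size are matched injectively and contribute \<open>e k\<close> mismatches; the others are small
  compared with \<open>10 * e k\<close>, because \<open>\<beta>\<^sup>2 < 5 / 3\<close>.\<close>

lemma exists_mismatches_le_broken_pairs_balanced:
  assumes st: "\<sigma> \<in> Sigma_bal n K \<beta>" "\<tau> \<in> Sigma_bal n K \<beta>"
    and beta: "1 \<le> \<beta>" "\<beta> < sqrt (5 / 3)" and K: "1 \<le> K"
  shows "\<exists>\<pi>. \<pi> permutes {1..K} \<and>
    real n * mismatches n \<pi> \<tau> \<sigma> \<le> 20 * \<beta> * K * card (broken_pairs n \<sigma> \<tau>)"
proof -
  define R where "R k l = card {i \<in> {1..n}. \<sigma> i = k \<and> \<tau> i = l}" for k l
  define N where "N k = card {i \<in> {1..n}. \<sigma> i = k}" for k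
  define N' where "N' l = card {i \<in> {1..n}. \<tau> i = l}" for l
  have sig: "\<sigma> i \<in> {1..K}" and tau: "\<tau> i \<in> {1..K}" if "i \<in> {1..n}" for i
    using st that by (auto simp: Sigma_bal_def)
  have N: "real n / (\<beta> * K) \<le> N k" "N k \<le> \<beta> * n / K" if "k \<in> {1..K}" for k
    using st(1) that by (auto simp: Sigma_bal_def N_def)
  have N': "N' l \<le> \<beta> * n / K" if "l \<in> {1..K}" for l
    using st(2) that by (auto simp: Sigma_bal_def N'_def)
  define f where "f k = (SOME l. l \<in> {1..K} \<and> (\<forall>l'\<in>{1..K}. R k l' \<le> R k l))" for k
  have f: "f k \<in> {1..K} \<and> (\<forall>l'\<in>{1..K}. R k l' \<le> R k (f k))" for k
    unfolding f_def
  proof (rule someI_ex)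
    have "Max (R k ` {1..K}) \<in> R k ` {1..K}" using K by (intro Max_in) auto
    then obtain l where "l \<in> {1..K}" "R k l = Max (R k ` {1..K})" by auto
    then show "\<exists>l. l \<in> {1..K} \<and> (\<forall>l'\<in>{1..K}. R k l' \<le> R k l)"
      by (metis Max_ge finite_atLeastAtMost finite_imageI imageI)
  qed
  define e where "e k = N k - R k (f k)" for k
  have RN: "R k l \<le> N k" for k l unfolding R_def N_def by (intro card_mono) auto
  have diff: "card {i \<in> {1..n}. \<sigma> i = k \<and> \<tau> i \<noteq> l} = N k - R k l" for k l
  proof -
    have eq: "{i \<in> {1..n}. \<sigma> i = k \<and> \<tau> i \<noteq> l}
        = {i \<in> {1..n}. \<sigma> i = k} - {i \<in> {1..n}. \<sigma> i = k \<and> \<tau> i = l}" by auto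
    show ?thesis unfolding N_def R_def eq by (rule card_Diff_subset) auto
  qed
  have fibres: "(\<Sum>i\<in>{1..n}. g i) = (\<Sum>k\<in>{1..K}. \<Sum>i\<in>{i \<in> {1..n}. \<sigma> i = k}. g i)" for g :: "nat \<Rightarrow> real"
    by (rule sum.group[symmetric]) (use sig in auto)
  \<comment> \<open>Inside its own cluster \<open>k\<close>, a vertex is separated by
    \<open>\<tau>\<close> from at least \<open>e k\<close> others, and balance gives the cluster at
    least \<open>n / (\<beta> * K)\<close> vertices. The factor 2 appears because each pair is seen
    from both endpoints.\<close>
  have lower: "n / (\<beta> * K) * (\<Sum>k\<in>{1..K}. real (e k)) \<le> 2 * card (broken_pairs n \<sigma> \<tau>)"
  proof -
    have "n / (\<beta> * K) * (\<Sum>k\<in>{1..K}. real (e k)) \<le> (\<Sum>k\<in>{1..K}. N k * real (e k))"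
      unfolding sum_distrib_left by (intro sum_mono mult_right_mono N) auto
    also have "\<dots> = (\<Sum>i\<in>{1..n}. real (e (\<sigma> i)))"
      unfolding fibres by (intro sum.cong) (auto simp: N_def)
    also have "\<dots> \<le> (\<Sum>i\<in>{1..n}. real (card {j \<in> {1..n}. \<sigma> i = \<sigma> j \<and> \<tau> i \<noteq> \<tau> j}))"
    proof (intro sum_mono)
      fix i assume i: "i \<in> {1..n}"
      have "{j \<in> {1..n}. \<sigma> i = \<sigma> j \<and> \<tau> i \<noteq> \<tau> j} = {j \<in> {1..n}. \<sigma> j = \<sigma> i \<and> \<tau> j \<noteq> \<tau> i}" by auto
      then have "card {j \<in> {1..n}. \<sigma> i = \<sigma> j \<and> \<tau> i \<noteq> \<tau> j} = N (\<sigma> i) - R (\<sigma> i) (\<tau> i)"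
        using diff by simp
      moreover have "R (\<sigma> i) (\<tau> i) \<le> R (\<sigma> i) (f (\<sigma> i))" using f tau[OF i] by blast
      ultimately show "real (e (\<sigma> i)) \<le> card {j \<in> {1..n}. \<sigma> i = \<sigma> j \<and> \<tau> i \<noteq> \<tau> j}"
        by (simp add: e_def)
    qed
    also have "\<dots> = 2 * card (broken_pairs n \<sigma> \<tau>)"
      using sum_vertex_broken_pairs[of n \<sigma> \<tau>] by (simp flip: of_nat_sum)
    finally show ?thesis .
  qed
  define G where "G = {k \<in> {1..K}. R k (f k) > \<beta> * n / (2 * K)}"
  \<comment> \<open>Two clusters in \<open>G\<close> with the same image would put more than
    \<open>\<beta> * n / K\<close> vertices into a single cluster of \<open>\<tau>\<close>.\<close>
  have "inj_on f G"
  proof (rule inj_onI, rule ccontr)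
    fix x y assume xy: "x \<in> G" "y \<in> G" "f x = f y" "x \<noteq> y"
    have "R x (f x) + R y (f x) = card ({i \<in> {1..n}. \<sigma> i = x \<and> \<tau> i = f x} \<union> {i \<in> {1..n}. \<sigma> i = y \<and> \<tau> i = f x})"
      unfolding R_def using xy by (intro card_Un_disjoint[symmetric]) auto
    also have "\<dots> \<le> N' (f x)" unfolding N'_def by (intro card_mono) auto
    finally have "real (R x (f x)) + R y (f y) \<le> \<beta> * n / K"
      using N'[of "f x"] f[of x] xy(3) by (simp flip: of_nat_add)
    moreover have "real (R x (f x)) + R y (f y) > \<beta> * n / (2 * K) + \<beta> * n / (2 * K)"
      using xy by (intro add_strict_mono) (auto simp: G_def)
    ultimately show False by simp
  qed
  moreover have "G \<subseteq> {1..K}" "f ` G \<subseteq> {1..K}" using f by (auto simp: G_def)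
  ultimately obtain \<pi> where \<pi>: "\<pi> permutes {1..K}" "\<And>k. k \<in> G \<Longrightarrow> \<pi> k = f k"
    using permutes_extension[of "{1..K}" f G] by blast
  have "real (mismatches n \<pi> \<tau> \<sigma>) = (\<Sum>i\<in>{1..n}. of_bool (\<tau> i \<noteq> \<pi> (\<sigma> i)))"
    by (simp add: mismatches_def Int_def)
  also have "\<dots> = (\<Sum>k\<in>{1..K}. real (N k - R k (\<pi> k)))"
    unfolding fibres diff[symmetric] by (intro sum.cong refl) (auto simp: Int_def intro!: arg_cong[where f = card])
  also have "\<dots> \<le> (\<Sum>k\<in>{1..K}. 10 * real (e k))"
  proof (intro sum_mono)
    fix k assume k: "k \<in> {1..K}"
    show "real (N k - R k (\<pi> k)) \<le> 10 * real (e k)"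
    proof (cases "k \<in> G")
      case True
      then show ?thesis by (simp add: \<pi> e_def)
    next
      case False
      \<comment> \<open>An unmatched cluster has at most \<open>5 / 6\<close> of its vertices in the
        largest intersection, so \<open>e k\<close> is at least a sixth of it; the factor 10 is
        generous.\<close>
      have "\<beta>\<^sup>2 < (sqrt (5 / 3))\<^sup>2" using beta by (intro power_strict_mono) auto
      then have b2: "\<beta> * \<beta> < 5 / 3" by (simp add: power2_eq_square)
      have "R k (f k) \<le> \<beta> * n / (2 * K)" using False k by (auto simp: G_def)
      also have "\<dots> = \<beta> * \<beta> / 2 * (n / (\<beta> * K))" using beta by simp
      also have "\<dots> \<le> \<beta> * \<beta> / 2 * N k" using N[OF k] beta by (intro mult_left_mono) auto
      also have "\<dots> \<le> 5 / 6 * N k" using b2 by (intro mult_right_mono) auto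
      finally have "real (N k) \<le> 10 * (real (N k) - R k (f k))" by simp
      then show ?thesis using RN[of k "f k"] by (simp add: e_def of_nat_diff)
    qed
  qed
  finally have mis: "real (mismatches n \<pi> \<tau> \<sigma>) \<le> 10 * (\<Sum>k\<in>{1..K}. real (e k))"
    by (simp add: sum_distrib_left)
  have bK: "\<beta> * K > 0" using beta K by simp
  \<comment> \<open>The constant 20 is 10 from the unmatched clusters times 2 from the double
    counting of pairs.\<close>
  have "real n * mismatches n \<pi> \<tau> \<sigma> \<le> real n * (10 * (\<Sum>k\<in>{1..K}. real (e k)))"
    using mis by (intro mult_left_mono) auto
  also have "\<dots> = 10 * (\<beta> * K) * (n / (\<beta> * K) * (\<Sum>k\<in>{1..K}. real (e k)))"
    using beta K by auto
  also have "\<dots> \<le> 10 * (\<beta> * K) * (2 * card (broken_pairs n \<sigma> \<tau>))"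
    using bK by (intro mult_left_mono lower) auto
  finally show ?thesis using \<pi>(1) by (intro exI[of _ \<pi>]) (auto simp: mult_ac)
qed

section \<open>The loss and the Chernoff exponent\<close>

text \<open>The balanced comparison relabels the labelling whose pairs are broken, whereas
  \<open>loss\<close> relabels its second argument; the inverse permutation passes between the
  two.\<close>

lemma mismatches_inverse:
  assumes "\<pi> permutes {1..K}"
  shows "mismatches n (inv \<pi>) \<tau> \<sigma> = mismatches n \<pi> \<sigma> \<tau>"
proof -
  have "(\<tau> i \<noteq> inv \<pi> (\<sigma> i)) = (\<sigma> i \<noteq> \<pi> (\<tau> i))" for i
    using permutes_inv_eq[OF assms] by metis
  then show ?thesis by (simp add: mismatches_def)
qed

lemma loss_eq_Min_mismatches:
  "loss n K \<sigma> \<tau> = Min ((\<lambda>\<pi>. real (mismatches n \<pi> \<sigma> \<tau>) / n) ` {\<pi>. \<pi> permutes {1..K}})"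
  by (simp add: loss_def mismatches_def Int_def)

lemma loss_le_mismatches:
  assumes "\<pi> permutes {1..K}"
  shows "loss n K \<sigma> \<tau> \<le> real (mismatches n \<pi> \<sigma> \<tau>) / n"
  unfolding loss_eq_Min_mismatches using assms by (intro Min_le) (auto simp: finite_permutations)

lemma loss_attained:
  obtains \<pi> where "\<pi> permutes {1..K}" "loss n K \<sigma> \<tau> = real (mismatches n \<pi> \<sigma> \<tau>) / n"
proof -
  have "loss n K \<sigma> \<tau> \<in> (\<lambda>\<pi>. real (mismatches n \<pi> \<sigma> \<tau>) / n) ` {\<pi>. \<pi> permutes {1..K}}"
    unfolding loss_eq_Min_mismatches by (intro Min_in) (auto simp: finite_permutations intro: permutes_id)
  then show thesis using that by auto
qed

lemma loss_nonneg: "0 \<le> loss n K \<sigma> \<tau>"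
  by (rule loss_attained[of K n \<sigma> \<tau>]) simp

lemma loss_le_1: "loss n K \<sigma> \<tau> \<le> 1"
proof -
  have "mismatches n id \<sigma> \<tau> \<le> card {1..n}" unfolding mismatches_def by (rule card_mono) auto
  then have "real (mismatches n id \<sigma> \<tau>) / n \<le> 1" by (auto simp: divide_le_eq_1)
  with loss_le_mismatches[OF permutes_id] show ?thesis by (rule order_trans)
qed

text \<open>The inequality of arithmetic and geometric means bounds the Bhattacharyya coefficient by
  1.\<close>

lemma info_nonneg:
  assumes "0 \<le> b" "b < a" "a < real n"
  shows "0 \<le> info n a b"
proof -
  define p q where "p = a / n" and "q = b / n"
  have pq: "0 \<le> q" "q < p" "p < 1"
    using assms by (auto simp: p_def q_def divide_strict_right_mono)
  have "sqrt (p * q) \<le> (p + q) / 2" "sqrt ((1 - p) * (1 - q)) \<le> ((1 - p) + (1 - q)) / 2"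
    using pq arith_geo_mean_sqrt[of p q] arith_geo_mean_sqrt[of "1 - p" "1 - q"] by auto
  then have "sqrt (p * q) + sqrt ((1 - p) * (1 - q)) \<le> 1" by simp
  then have "ln (sqrt (p * q) + sqrt ((1 - p) * (1 - q))) \<le> 0"
    using bhattacharyya_pos[OF pq] by simp
  then show ?thesis by (simp add: info_def p_def q_def)
qed

text \<open>Up to the factor 20, every mismatch costs one signal. For \<open>K = 2\<close> the bound
  on the sum of the two counts suffices; for larger \<open>K\<close> each count is bounded
  separately, so any weight \<open>w\<close> is admissible.\<close>

lemma chernoff_exponent_ge:
  assumes st: "\<sigma> \<in> Sigma_bal n K \<beta>" "\<tau> \<in> Sigma_bal n K \<beta>"
    and beta: "1 \<le> \<beta>" "3 \<le> K \<Longrightarrow> \<beta> < sqrt (5 / 3)" and K: "2 \<le> K"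
    and w: "0 \<le> w" "w \<le> 1" and n: "0 < n" and I: "0 \<le> info n a b"
  shows "real n * loss n K \<sigma> \<tau> * (signal n K \<beta> a b / 20)
    \<le> info n a b * (weight K w * card (broken_pairs n \<tau> \<sigma>) + (1 - weight K w) * card (broken_pairs n \<sigma> \<tau>))"
proof (cases "K = 2")
  case True
  have "\<sigma> \<in> {1..n} \<rightarrow>\<^sub>E {1..2}" "\<tau> \<in> {1..n} \<rightarrow>\<^sub>E {1..2}" using st True by (auto simp: Sigma_bal_def)
  then obtain \<pi> where \<pi>: "\<pi> permutes {1..2}"
    "n * mismatches n \<pi> \<sigma> \<tau> \<le> 2 * (card (broken_pairs n \<sigma> \<tau>) + card (broken_pairs n \<tau> \<sigma>))"
    using exists_mismatches_le_broken_pairs_two_clusters by blast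
  have "real n * (real n * loss n K \<sigma> \<tau>) \<le> real n * mismatches n \<pi> \<sigma> \<tau>"
    using loss_le_mismatches[of \<pi> K n \<sigma> \<tau>] \<pi>(1) True n by (intro mult_left_mono) (auto simp: field_simps)
  also have "\<dots> \<le> 2 * (real (card (broken_pairs n \<sigma> \<tau>)) + card (broken_pairs n \<tau> \<sigma>))"
    using of_nat_mono[OF \<pi>(2), where 'a = real] by simp
  \<comment> \<open>The divisor 40 combines the common factor 20 with the 2 in the definition of
    \<open>signal\<close> for two clusters.\<close>
  finally have "real n * (real n * loss n K \<sigma> \<tau>) / 40
      \<le> weight K w * card (broken_pairs n \<tau> \<sigma>) + (1 - weight K w) * card (broken_pairs n \<sigma> \<tau>)"
    using True by (simp add: weight_def)
  from mult_left_mono[OF this I] show ?thesis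
    using True by (simp add: signal_def algebra_simps)
next
  case False
  then have K3: "3 \<le> K" and K1: "1 \<le> K" using K by auto
  \<comment> \<open>A common lower bound for both broken-pair counts, hence for each of their convex
    combinations.\<close>
  define x where "x = real n * (real n * loss n K \<sigma> \<tau>) / (20 * \<beta> * K)"
  have bK: "20 * \<beta> * K > 0" using beta(1) K by simp
  have le: "x \<le> m" if "\<pi> permutes {1..K}" "real n * mismatches n \<pi> \<sigma> \<tau> \<le> 20 * \<beta> * K * m" for \<pi> m
  proof -
    have "real n * (real n * loss n K \<sigma> \<tau>) \<le> real n * mismatches n \<pi> \<sigma> \<tau>"
      using loss_le_mismatches[OF that(1), of n \<sigma> \<tau>] n by (intro mult_left_mono) (auto simp: field_simps)
    with that(2) show ?thesis unfolding x_def using bK by (simp add: pos_divide_le_eq mult.commute)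
  qed
  obtain \<pi> where \<pi>: "\<pi> permutes {1..K}" "real n * mismatches n \<pi> \<tau> \<sigma> \<le> 20 * \<beta> * K * card (broken_pairs n \<sigma> \<tau>)"
    using exists_mismatches_le_broken_pairs_balanced[OF st beta(1) beta(2)[OF K3] K1] by blast
  have 1: "x \<le> card (broken_pairs n \<sigma> \<tau>)"
    by (rule le[OF permutes_inv[OF \<pi>(1)]]) (use \<pi>(2) mismatches_inverse[OF \<pi>(1)] in simp)
  obtain \<pi>' where \<pi>': "\<pi>' permutes {1..K}" "real n * mismatches n \<pi>' \<sigma> \<tau> \<le> 20 * \<beta> * K * card (broken_pairs n \<tau> \<sigma>)"
    using exists_mismatches_le_broken_pairs_balanced[OF st(2,1) beta(1) beta(2)[OF K3] K1] by blast
  have 2: "x \<le> card (broken_pairs n \<tau> \<sigma>)" by (rule le[OF \<pi>'])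
  have v: "weight K w = w" using False by (simp add: weight_def)
  have "x = w * x + (1 - w) * x" by (simp add: algebra_simps)
  also have "\<dots> \<le> w * card (broken_pairs n \<tau> \<sigma>) + (1 - w) * card (broken_pairs n \<sigma> \<tau>)"
    using 1 2 w by (intro add_mono mult_left_mono) auto
  finally have "info n a b * x \<le> info n a b * (weight K w * card (broken_pairs n \<tau> \<sigma>) + (1 - weight K w) * card (broken_pairs n \<sigma> \<tau>))"
    unfolding v using I by (rule mult_left_mono)
  then show ?thesis using False by (simp add: x_def signal_def mult_ac)
qed

section \<open>Union bound over all labellings\<close>

text \<open>For a fixed relabelling the sum factorises over vertices. At each vertex at most one
  label is free of cost, so the factor is at most \<open>1 + K * exp (- y)\<close>, which
  \<open>1 + x \<le> exp x\<close> turns into an exponential.\<close>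

lemma sum_exp_mismatches_le:
  assumes "\<pi> permutes {1..K}"
  shows "(\<Sum>\<tau>\<in>{1..n} \<rightarrow>\<^sub>E {1..K}. exp (- (real (mismatches n \<pi> \<sigma> \<tau>) * y))) \<le> exp (real n * K * exp (- y))"
proof -
  have eq: "exp (- (real (mismatches n \<pi> \<sigma> \<tau>) * y)) = (\<Prod>i\<in>{1..n}. if \<sigma> i \<noteq> \<pi> (\<tau> i) then exp (- y) else 1)" for \<tau>
    by (simp add: mismatches_def prod.If_cases Int_def flip: exp_of_nat_mult)
  have inner: "(\<Sum>k\<in>{1..K}. if s \<noteq> \<pi> k then exp (- y) else 1) \<le> exp (K * exp (- y))" for s
  proof -
    have "(\<Sum>k\<in>{1..K}. if s \<noteq> \<pi> k then exp (- y) else 1) \<le> (\<Sum>k\<in>{1..K}. exp (- y) + (if k = inv \<pi> s then 1 else 0))"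
      using permutes_inverses(2)[OF assms] by (intro sum_mono) auto
    also have "\<dots> \<le> K * exp (- y) + 1" by (simp add: sum.distrib)
    also have "\<dots> \<le> exp (K * exp (- y))" using exp_ge_add_one_self[of "K * exp (- y)"] by linarith
    finally show ?thesis .
  qed
  have "(\<Sum>\<tau>\<in>{1..n} \<rightarrow>\<^sub>E {1..K}. exp (- (real (mismatches n \<pi> \<sigma> \<tau>) * y)))
      = (\<Prod>i\<in>{1..n}. \<Sum>k\<in>{1..K}. if \<sigma> i \<noteq> \<pi> k then exp (- y) else 1)"
    unfolding eq by (rule prod_sum_PiE[symmetric]) auto
  also have "\<dots> \<le> (\<Prod>i\<in>{1..n}. exp (K * exp (- y)))"
    by (intro prod_mono conjI inner sum_nonneg) auto
  also have "\<dots> = exp (real n * K * exp (- y))" by (simp flip: exp_of_nat_mult add: mult_ac)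
  finally show ?thesis .
qed

text \<open>At least one mismatch: half of the exponent pays for the union over all labellings.\<close>

lemma sum_exp_loss_le:
  assumes n: "0 < n" and y: "0 \<le> y" "real n * K * exp (- (y / 2)) \<le> 1"
    and S: "S \<subseteq> {1..n} \<rightarrow>\<^sub>E {1..K}" "\<And>\<tau>. \<tau> \<in> S \<Longrightarrow> loss n K \<sigma> \<tau> \<noteq> 0"
  shows "(\<Sum>\<tau>\<in>S. exp (- (real n * loss n K \<sigma> \<tau> * y))) \<le> fact K * exp (1 - y / 2)"
proof -
  define P where "P = {\<pi>. \<pi> permutes {1..K}}"
  have P: "finite P" "card P = fact K"
    by (auto simp: P_def finite_permutations card_permutations[OF refl])
  have fin: "finite ({1..n} \<rightarrow>\<^sub>E {1..K})" by (intro finite_PiE) auto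
  \<comment> \<open>The optimal relabelling depends on \<open>\<tau>\<close>; summing over all of
    them removes the dependence at the price of the factor \<open>fact K\<close>.\<close>
  have pt: "exp (- (real n * loss n K \<sigma> \<tau> * y))
      \<le> (\<Sum>\<pi>\<in>P. exp (- (y / 2)) * exp (- (real (mismatches n \<pi> \<sigma> \<tau>) * (y / 2))))" if "\<tau> \<in> S" for \<tau>
  proof -
    obtain \<pi> where \<pi>: "\<pi> permutes {1..K}" "loss n K \<sigma> \<tau> = real (mismatches n \<pi> \<sigma> \<tau>) / n"
      by (rule loss_attained)
    define m where "m = mismatches n \<pi> \<sigma> \<tau>"
    have "m \<noteq> 0" using S(2)[OF that] \<pi>(2) by (auto simp: m_def)
    then have "1 * (y / 2) \<le> real m * (y / 2)" using y by (intro mult_right_mono) auto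
    then have "exp (- (real n * loss n K \<sigma> \<tau> * y)) \<le> exp (- (y / 2)) * exp (- (real m * (y / 2)))"
      using n by (simp add: \<pi>(2) flip: m_def exp_add)
    also have "\<dots> \<le> (\<Sum>\<pi>\<in>P. exp (- (y / 2)) * exp (- (real (mismatches n \<pi> \<sigma> \<tau>) * (y / 2))))"
      unfolding m_def using \<pi>(1) P by (intro member_le_sum) (auto simp: P_def)
    finally show ?thesis .
  qed
  have "(\<Sum>\<tau>\<in>S. exp (- (real n * loss n K \<sigma> \<tau> * y)))
      \<le> (\<Sum>\<tau>\<in>S. \<Sum>\<pi>\<in>P. exp (- (y / 2)) * exp (- (real (mismatches n \<pi> \<sigma> \<tau>) * (y / 2))))"
    by (intro sum_mono pt)
  also have "\<dots> \<le> (\<Sum>\<tau>\<in>{1..n} \<rightarrow>\<^sub>E {1..K}. \<Sum>\<pi>\<in>P. exp (- (y / 2)) * exp (- (real (mismatches n \<pi> \<sigma> \<tau>) * (y / 2))))"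
    using S(1) fin by (intro sum_mono2 sum_nonneg) auto
  also have "\<dots> = (\<Sum>\<pi>\<in>P. exp (- (y / 2)) * (\<Sum>\<tau>\<in>{1..n} \<rightarrow>\<^sub>E {1..K}. exp (- (real (mismatches n \<pi> \<sigma> \<tau>) * (y / 2)))))"
    unfolding sum_distrib_left by (rule sum.swap)
  also have "\<dots> \<le> (\<Sum>\<pi>\<in>P. exp (- (y / 2)) * exp 1)"
  proof (intro sum_mono mult_left_mono)
    fix \<pi> assume "\<pi> \<in> P"
    then have "(\<Sum>\<tau>\<in>{1..n} \<rightarrow>\<^sub>E {1..K}. exp (- (real (mismatches n \<pi> \<sigma> \<tau>) * (y / 2)))) \<le> exp (real n * K * exp (- (y / 2)))"
      by (intro sum_exp_mismatches_le) (simp add: P_def)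
    also have "\<dots> \<le> exp 1" using y(2) by simp
    finally show "(\<Sum>\<tau>\<in>{1..n} \<rightarrow>\<^sub>E {1..K}. exp (- (real (mismatches n \<pi> \<sigma> \<tau>) * (y / 2)))) \<le> exp 1" .
  qed auto
  also have "\<dots> = fact K * exp (1 - y / 2)" by (simp add: P flip: exp_add)
  finally show ?thesis .
qed

section \<open>Risk of the private estimator\<close>

text \<open>The tower rule, obtained through nonnegative integrals; the bounds on \<open>f\<close>
  supply the integrability for returning to real expectations.\<close>

lemma expectation_bind_pmf_bounded:
  fixes f :: "'a \<Rightarrow> real"
  assumes "\<And>x. 0 \<le> f x" "\<And>x. f x \<le> B"
  shows "measure_pmf.expectation (bind_pmf p M) f = measure_pmf.expectation p (\<lambda>x. measure_pmf.expectation (M x) f)"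
proof -
  have int: "integrable (measure_pmf q) f" for q :: "'a pmf"
    by (rule measure_pmf.integrable_const_bound[where B = B]) (use assms in auto)
  have nn: "0 \<le> measure_pmf.expectation q f" for q by (rule integral_nonneg_AE) (use assms in auto)
  have le: "measure_pmf.expectation q f \<le> B" for q
    using measure_pmf.integral_le_const[OF int[of q], of B] assms by auto
  have int2: "integrable (measure_pmf p) (\<lambda>x. measure_pmf.expectation (M x) f)"
    by (rule measure_pmf.integrable_const_bound[where B = B]) (use nn le in auto)
  have "ennreal (measure_pmf.expectation (bind_pmf p M) f) = (\<integral>\<^sup>+x. f x \<partial>bind_pmf p M)"
    by (rule nn_integral_eq_integral[symmetric, OF int]) (use assms in auto)
  also have "\<dots> = (\<integral>\<^sup>+x. ennreal (measure_pmf.expectation (M x) f) \<partial>p)"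
    unfolding nn_integral_bind_pmf
    by (intro nn_integral_cong nn_integral_eq_integral[OF int]) (use assms in auto)
  also have "\<dots> = ennreal (measure_pmf.expectation p (\<lambda>x. measure_pmf.expectation (M x) f))"
    by (rule nn_integral_eq_integral[OF int2]) (use nn in auto)
  finally show ?thesis using nn by (subst (asm) ennreal_inj) (auto intro!: integral_nonneg_AE)
qed

lemma finite_Sigma_bal: "finite (Sigma_bal n K \<beta>)"
  by (rule finite_subset[of _ "{1..n} \<rightarrow>\<^sub>E {1..K}"]) (auto simp: Sigma_bal_def intro: finite_PiE)

text \<open>Keeping only the \<open>\<sigma>\<close> term of the normalising sum gives the
  likelihood ratio, keeping only the \<open>\<tau>\<close> term gives 1.\<close>

lemma exp_mech_prob_le:
  assumes "\<sigma> \<in> Sigma_bal n K \<beta>" "\<tau> \<in> Sigma_bal n K \<beta>"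
  shows "exp_mech_prob n K \<beta> w C a b \<epsilon> A \<tau>
    \<le> min 1 (exp (\<epsilon> / (2 * sensitivity n C a) * (score n K w a b A \<tau> - score n K w a b A \<sigma>)))"
proof -
  define E where "E \<rho> = exp (\<epsilon> / (2 * sensitivity n C a) * score n K w a b A \<rho>)" for \<rho>
  define Z where "Z = (\<Sum>\<rho>\<in>Sigma_bal n K \<beta>. E \<rho>)"
  have le: "E \<rho> \<le> Z" if "\<rho> \<in> Sigma_bal n K \<beta>" for \<rho>
    unfolding Z_def using that finite_Sigma_bal by (intro member_le_sum) (auto simp: E_def)
  have "E \<rho> > 0" for \<rho> by (simp add: E_def)
  then have "E \<tau> / Z \<le> E \<tau> / E \<sigma>" "E \<tau> / Z \<le> 1"
    using le[OF assms(1)] le[OF assms(2)] less_le_trans[of 0 "E \<sigma>" Z]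
    by (auto intro!: divide_left_mono simp: less_imp_le divide_le_eq_1)
  then show ?thesis
    by (simp add: exp_mech_prob_def E_def Z_def right_diff_distrib exp_diff)
qed

text \<open>Outside the envelope the mechanism has no explicit law, so the loss is bounded by 1
  there. On the envelope only labellings of nonzero loss contribute, each with at most its
  probability.\<close>

lemma risk_le_sum:
  assumes M: "private_estimator n K \<beta> w C a b \<epsilon> M" and s: "\<sigma> \<in> Sigma_bal n K \<beta>"
  defines "S \<equiv> {\<tau> \<in> Sigma_bal n K \<beta>. loss n K \<sigma> \<tau> \<noteq> 0}"
  defines "h \<equiv> \<lambda>A \<tau>. min 1 (exp (\<epsilon> / 2 / (2 * sensitivity n C a) * (score n K w a b A \<tau> - score n K w a b A \<sigma>)))"
  shows "risk n K a b M \<sigma> \<le> 1 - measure_pmf.prob (sbm n a b \<sigma>) (envelope n C a)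
    + (\<Sum>\<tau>\<in>S. measure_pmf.expectation (sbm n a b \<sigma>) (\<lambda>A. h A \<tau>))"
proof -
  let ?l = "loss n K \<sigma>" and ?e = "envelope n C a"
  have finS: "finite S" unfolding S_def using finite_Sigma_bal by auto
  have h: "0 \<le> h A \<tau>" "h A \<tau> \<le> 1" for A \<tau> by (auto simp: h_def)
  have inth: "integrable (measure_pmf p) (\<lambda>A. h A \<tau>)" for p :: "graph pmf" and \<tau>
    by (rule measure_pmf.integrable_const_bound[where B = 1]) (use h in auto)
  have inti: "integrable (measure_pmf p) (indicator (- ?e) :: graph \<Rightarrow> real)" for p
    by (rule measure_pmf.integrable_const_bound[where B = 1]) auto
  have le1: "measure_pmf.expectation q ?l \<le> 1" for q
    by (rule measure_pmf.integral_le_const, rule measure_pmf.integrable_const_bound[where B = 1])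
       (use loss_nonneg loss_le_1 in auto)
  have nn: "0 \<le> measure_pmf.expectation q ?l" for q by (rule integral_nonneg_AE) (use loss_nonneg in auto)
  have pt: "measure_pmf.expectation (M A) ?l \<le> indicator (- ?e) A + (\<Sum>\<tau>\<in>S. h A \<tau>)" for A
  proof (cases "A \<in> ?e")
    case True
    have sup: "set_pmf (M A) \<subseteq> Sigma_bal n K \<beta>"
      using M True by (auto simp: private_estimator_def envelope_def)
    have "measure_pmf.expectation (M A) ?l = (\<Sum>\<tau>\<in>S. ?l \<tau> * pmf (M A) \<tau>)"
      by (rule integral_measure_pmf_real[OF finS]) (use sup in \<open>auto simp: S_def\<close>)
    also have "\<dots> \<le> (\<Sum>\<tau>\<in>S. 1 * h A \<tau>)"
    proof (intro sum_mono mult_mono loss_le_1)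
      fix \<tau> assume \<tau>: "\<tau> \<in> S"
      then have "pmf (M A) \<tau> = exp_mech_prob n K \<beta> w C a b (\<epsilon> / 2) A \<tau>"
        using M True by (auto simp: private_estimator_def S_def)
      also have "\<dots> \<le> h A \<tau>"
        unfolding h_def by (rule exp_mech_prob_le[OF s]) (use \<tau> in \<open>simp add: S_def\<close>)
      finally show "pmf (M A) \<tau> \<le> h A \<tau>" .
    qed auto
    finally show ?thesis using True by simp
  next
    case False
    then show ?thesis using le1[of "M A"] sum_nonneg[of S "h A"] h by (simp add: add_increasing2)
  qed
  have "risk n K a b M \<sigma> = measure_pmf.expectation (sbm n a b \<sigma>) (\<lambda>A. measure_pmf.expectation (M A) ?l)"
    unfolding risk_def by (rule expectation_bind_pmf_bounded[OF loss_nonneg loss_le_1])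
  also have "\<dots> \<le> measure_pmf.expectation (sbm n a b \<sigma>) (\<lambda>A. indicator (- ?e) A + (\<Sum>\<tau>\<in>S. h A \<tau>))"
  proof (rule integral_mono[OF _ _ pt])
    show "integrable (measure_pmf (sbm n a b \<sigma>)) (\<lambda>A. measure_pmf.expectation (M A) ?l)"
      by (rule measure_pmf.integrable_const_bound[where B = 1]) (use nn le1 in auto)
    show "integrable (measure_pmf (sbm n a b \<sigma>)) (\<lambda>A. indicator (- ?e) A + (\<Sum>\<tau>\<in>S. h A \<tau>))"
      by (intro Bochner_Integration.integrable_add Bochner_Integration.integrable_sum inth inti)
  qed
  also have "\<dots> = measure_pmf.prob (sbm n a b \<sigma>) (- ?e) + (\<Sum>\<tau>\<in>S. measure_pmf.expectation (sbm n a b \<sigma>) (\<lambda>A. h A \<tau>))"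
    by (subst Bochner_Integration.integral_add)
       (auto intro!: Bochner_Integration.integrable_sum inth inti simp: Bochner_Integration.integral_sum inth)
  also have "measure_pmf.prob (sbm n a b \<sigma>) (- ?e) = 1 - measure_pmf.prob (sbm n a b \<sigma>) ?e"
    using measure_pmf.prob_compl[of ?e "sbm n a b \<sigma>"] by (simp add: Compl_eq_Diff_UNIV)
  finally show ?thesis .
qed

text \<open>As \<open>n * loss\<close> is the number of mismatches, \<open>y\<close> is the exponent
  gained per mismatch: the signal over 20, damped when privacy forces a tilt below
  \<open>tstar\<close>.\<close>

lemma risk_le_chernoff:
  assumes M: "private_estimator n K \<beta> w C a b \<epsilon> M" and s: "\<sigma> \<in> Sigma_bal n K \<beta>"
    and beta: "1 \<le> \<beta>" "3 \<le> K \<Longrightarrow> \<beta> < sqrt (5 / 3)" and K: "2 \<le> K"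
    and w: "0 \<le> w" "w \<le> 1" and n: "0 < n" and ab: "0 < b" "b < a" "a < real n"
    and eps: "0 \<le> \<epsilon>" and C: "0 < C"
  defines "y \<equiv> min 1 (\<epsilon> / (4 * sensitivity n C a) / tstar n a b) * (signal n K \<beta> a b / 20)"
  assumes y: "0 \<le> y" "real n * K * exp (- (y / 2)) \<le> 1"
  shows "risk n K a b M \<sigma> \<le> 1 - measure_pmf.prob (sbm n a b \<sigma>) (envelope n C a) + fact K * exp (1 - y / 2)"
proof -
  define S where "S = {\<tau> \<in> Sigma_bal n K \<beta>. loss n K \<sigma> \<tau> \<noteq> 0}"
  \<comment> \<open>The 4 combines the halved budget with the 2 in the exponential
    mechanism.\<close>
  define \<eta> \<theta> where "\<eta> = \<epsilon> / (4 * sensitivity n C a)" and "\<theta> = min 1 (\<eta> / tstar n a b)"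
  define h where "h A \<tau> = min 1 (exp (\<eta> * (score n K w a b A \<tau> - score n K w a b A \<sigma>)))" for A \<tau>
  have t: "0 < tstar n a b" by (rule tstar_pos[OF ab])
  have \<eta>: "0 \<le> \<eta>" using eps C ab by (simp add: \<eta>_def sensitivity_def)
  then have \<theta>: "0 \<le> \<theta>" using t by (simp add: \<theta>_def)
  have I: "0 \<le> info n a b" using ab by (intro info_nonneg) auto
  have "measure_pmf.expectation (sbm n a b \<sigma>) (\<lambda>A. h A \<tau>) \<le> exp (- (real n * loss n K \<sigma> \<tau> * y))"
    if \<tau>: "\<tau> \<in> S" for \<tau>
  proof -
    define J where "J = info n a b * (weight K w * card (broken_pairs n \<tau> \<sigma>)
      + (1 - weight K w) * card (broken_pairs n \<sigma> \<tau>))"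
    have mgf: "measure_pmf.expectation (sbm n a b \<sigma>)
        (\<lambda>A. exp (tstar n a b * (score n K w a b A \<tau> - score n K w a b A \<sigma>))) = exp (- J)"
      unfolding J_def by (rule expectation_exp_score_diff[OF ab])
    have "integrable (measure_pmf (sbm n a b \<sigma>))
        (\<lambda>A. exp (tstar n a b * (score n K w a b A \<tau> - score n K w a b A \<sigma>)))"
      
    \<comment> \<open>A function that is not integrable has integral 0 by convention, whereas the
      moment just computed is positive.\<close>
    proof (rule ccontr)
      assume "\<not> ?thesis"
      from not_integrable_integral_eq[OF this] mgf show False by simp
    qed
    from expectation_min_exp_le[OF this mgf t \<eta>]
    have "measure_pmf.expectation (sbm n a b \<sigma>) (\<lambda>A. h A \<tau>) \<le> exp (- (\<theta> * J))"
      by (simp add: h_def \<theta>_def)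
    also have "real n * loss n K \<sigma> \<tau> * (signal n K \<beta> a b / 20) \<le> J"
      unfolding J_def using \<tau> s by (intro chernoff_exponent_ge beta K w n I) (auto simp: S_def)
    then have "\<theta> * (real n * loss n K \<sigma> \<tau> * (signal n K \<beta> a b / 20)) \<le> \<theta> * J"
      using \<theta> by (rule mult_left_mono)
    then have "exp (- (\<theta> * J)) \<le> exp (- (real n * loss n K \<sigma> \<tau> * y))"
      by (simp add: y_def \<theta>_def \<eta>_def mult_ac)
    finally show ?thesis .
  qed
  then have "(\<Sum>\<tau>\<in>S. measure_pmf.expectation (sbm n a b \<sigma>) (\<lambda>A. h A \<tau>)) \<le> (\<Sum>\<tau>\<in>S. exp (- (real n * loss n K \<sigma> \<tau> * y)))"
    by (rule sum_mono)
  also have "\<dots> \<le> fact K * exp (1 - y / 2)"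
    by (rule sum_exp_loss_le[OF n y]) (auto simp: S_def Sigma_bal_def)
  finally have "(\<Sum>\<tau>\<in>S. measure_pmf.expectation (sbm n a b \<sigma>) (\<lambda>A. h A \<tau>)) \<le> fact K * exp (1 - y / 2)" .
  moreover have "\<epsilon> / 2 / (2 * sensitivity n C a) = \<eta>" by (simp add: \<eta>_def)
  ultimately show ?thesis using risk_le_sum[OF M s] unfolding S_def h_def by simp
qed

section \<open>Orders of magnitude of information, tilt and signal\<close>

text \<open>Replacing \<open>q\<close> by \<open>p\<close> and dropping the first root bounds the
  Bhattacharyya coefficient below by \<open>1 - p\<close>, and \<open>ln (1 - p)\<close> is at least
  \<open>- 2 * p\<close> for \<open>p\<close> up to one half.\<close>

lemma info_le:
  assumes "0 \<le> b" "b < a" "a \<le> real n / 2"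
  shows "real n * info n a b \<le> 4 * a"
proof -
  have n: "real n > 0" using assms by auto
  define p q where "p = a / n" and "q = b / n"
  have pq: "0 \<le> q" "q < p" "p \<le> 1 / 2"
    using assms n by (auto simp: p_def q_def divide_strict_right_mono field_simps)
  have "1 - p = sqrt ((1 - p) * (1 - p))" using pq by simp
  also have "\<dots> \<le> sqrt ((1 - p) * (1 - q))"
    using pq by (intro real_sqrt_le_mono mult_left_mono) auto
  also have "\<dots> \<le> sqrt (p * q) + sqrt ((1 - p) * (1 - q))" using pq by simp
  finally have "ln (1 - p) \<le> ln (sqrt (p * q) + sqrt ((1 - p) * (1 - q)))" using pq by (intro ln_mono) auto
  moreover have "- p - 2 * p\<^sup>2 \<le> ln (1 - p)"
    using pq by (intro ln_one_minus_pos_lower_bound) auto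
  moreover have "2 * p\<^sup>2 \<le> p" using mult_left_mono[of p "1 / 2" p] pq by (simp add: power2_eq_square)
  ultimately have "info n a b \<le> 4 * p" by (simp add: info_def p_def q_def)
  from mult_left_mono[OF this, of "real n"] show ?thesis using n by (simp add: p_def)
qed

text \<open>By \<open>ln x \<le> x - 1\<close> and the arithmetic-geometric mean inequality, the
  information dominates \<open>(sqrt p - sqrt q)\<^sup>2\<close>, which has order \<open>p\<close>
  when the ratio \<open>q / p\<close> is bounded away from 1.\<close>

lemma info_ge:
  assumes "0 \<le> b" "b < a" "a < real n" "b \<le> r * a"
    and r: "0 \<le> r" "r \<le> 1"
  shows "a * (1 - sqrt r)\<^sup>2 \<le> real n * info n a b"
proof -
  define p q where "p = a / n" and "q = b / n"
  have pq: "0 \<le> q" "q < p" "p < 1" "q \<le> r * p"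
    using assms by (auto simp: p_def q_def divide_strict_right_mono field_simps)
  let ?B = "sqrt (p * q) + sqrt ((1 - p) * (1 - q))"
  have "sqrt ((1 - p) * (1 - q)) \<le> ((1 - p) + (1 - q)) / 2"
    using pq by (intro arith_geo_mean_sqrt) auto
  moreover have "(sqrt p - sqrt q)\<^sup>2 = p + q - 2 * sqrt (p * q)"
    using pq by (simp add: power2_diff real_sqrt_mult)
  moreover have "ln ?B \<le> ?B - 1" by (rule ln_le_minus_one, rule bhattacharyya_pos) (use pq in auto)
  ultimately have I: "(sqrt p - sqrt q)\<^sup>2 \<le> info n a b" by (simp add: info_def p_def q_def)
  have "sqrt q \<le> sqrt r * sqrt p" using pq(4) by (simp flip: real_sqrt_mult)
  then have "sqrt p * (1 - sqrt r) \<le> sqrt p - sqrt q" by (simp add: algebra_simps)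
  then have "(sqrt p * (1 - sqrt r))\<^sup>2 \<le> (sqrt p - sqrt q)\<^sup>2"
    using pq r by (intro power_mono mult_nonneg_nonneg) auto
  with I have "p * (1 - sqrt r)\<^sup>2 \<le> info n a b" using pq by (simp add: power_mult_distrib)
  from mult_left_mono[OF this, of "real n"] show ?thesis using assms by (simp add: p_def)
qed

text \<open>The odds ratio is at most \<open>2 / r\<close>. A bounded tilt matters because the
  privacy exponent is divided by it.\<close>

lemma tstar_le:
  assumes "0 < b" "b < a" "a \<le> real n / 2" "r * a \<le> b" and r: "0 < r"
  shows "tstar n a b \<le> 1 / 2 * ln (2 / r)"
proof -
  have n: "real n > 0" using assms by auto
  have p: "1 / 2 \<le> 1 - a / n" and q: "1 - b / n \<le> 1" "0 < 1 - b / n" using assms n by (auto simp: field_simps)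
  have "a * (1 - b / n) \<le> a" using q assms by (intro mult_left_le) auto
  also have "a \<le> b / r" using assms by (simp add: field_simps)
  also have "b / r \<le> 2 / r * (b * (1 - a / n))"
    using mult_left_mono[OF p, of b] assms by (simp add: field_simps)
  finally have "a * (1 - b / n) / (b * (1 - a / n)) \<le> 2 / r"
    using p assms by (subst pos_divide_le_eq) auto
  moreover have "0 < a * (1 - b / n) / (b * (1 - a / n))" using p q assms by auto
  ultimately have "ln (a * (1 - b / n) / (b * (1 - a / n))) \<le> ln (2 / r)" by (rule ln_mono)
  then show ?thesis by (simp add: tstar_def)
qed

text \<open>Lets the failure probability of the envelope, exponentially small in \<open>a\<close>,
  be charged to the signal.\<close>

lemma signal_le:
  assumes "0 \<le> b" "b < a" "a \<le> real n / 2" "1 \<le> \<beta>" "2 \<le> K"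
  shows "signal n K \<beta> a b \<le> 2 * a"
proof -
  have "2 * 1 \<le> real K * \<beta>" using assms by (intro mult_mono) auto
  moreover have "0 \<le> real n * info n a b" using assms by (intro mult_nonneg_nonneg info_nonneg) auto
  ultimately have "real n * info n a b / (\<beta> * K) \<le> real n * info n a b / 2"
    by (intro divide_left_mono) (auto simp: mult.commute)
  then have "signal n K \<beta> a b \<le> real n * info n a b / 2" by (cases "K = 2") (simp_all only: signal_def if_True if_False order_refl simp_thms)
  then show ?thesis using info_le[OF assms(1-3)] by linarith
qed

text \<open>Shows that the signal has order at least \<open>a\<close>, the scale of the sensitivity,
  so that the privacy exponent is linear in \<open>\<epsilon>\<close>. The number \<open>m\<close>
  stands for a uniform bound on \<open>K\<close>.\<close>

lemma signal_ge:
  assumes ab: "0 \<le> b" "b < a" "a < real n" "b \<le> r * a" and r: "0 \<le> r" "r \<le> 1"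
    and beta: "1 \<le> \<beta>" and K: "2 \<le> K" "K \<le> m"
  shows "a * ((1 - sqrt r)\<^sup>2 / (\<beta> * m)) \<le> signal n K \<beta> a b"
proof -
  define X where "X = real n * info n a b"
  have X: "0 \<le> X" unfolding X_def using ab by (intro mult_nonneg_nonneg info_nonneg) auto
  have "1 * 2 \<le> \<beta> * m" using K beta by (intro mult_mono) auto
  then have 1: "X / (\<beta> * m) \<le> X / 2" using X by (intro divide_left_mono) auto
  have "\<beta> * K \<le> \<beta> * m" "0 < \<beta> * K" "0 < \<beta> * m" using K beta by auto
  then have 2: "X / (\<beta> * m) \<le> X / (\<beta> * K)"
    using X by (intro divide_left_mono mult_pos_pos[of "\<beta> * m"])
  have "X / (\<beta> * m) \<le> signal n K \<beta> a b"
    unfolding signal_def X_def[symmetric] using 1 2 by (simp only: split: if_split) blast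
  moreover have "a * (1 - sqrt r)\<^sup>2 / (\<beta> * m) \<le> X / (\<beta> * m)"
    unfolding X_def using info_ge[OF ab r] beta K by (intro divide_right_mono) auto
  ultimately show ?thesis by simp
qed

section \<open>From the Chernoff bound to the stated rate\<close>

text \<open>The bound for a fixed \<open>n\<close>. The exponent \<open>y\<close> is at least the
  minimum of \<open>s / 20\<close> and \<open>c * \<epsilon>\<close>, and the two terms of the
  conclusion correspond to the two cases of this minimum.\<close>

lemma risk_le_exp_signal_add_exp_eps:
  fixes \<beta> C w \<epsilon> a b c :: real
  assumes M: "private_estimator n K \<beta> w C a b \<epsilon> M" and s: "\<sigma> \<in> Sigma_bal n K \<beta>"
    and beta: "1 \<le> \<beta>" "3 \<le> K \<Longrightarrow> \<beta> < sqrt (5 / 3)" and K: "2 \<le> K" "K \<le> n"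
    and w: "0 \<le> w" "w \<le> 1" and ab: "0 < b" "b < a" "a \<le> real n / 2"
    and C: "0 < C" and c: "0 < c"
    and env: "1 - exp (- 10 * (a + ln n)) \<le> measure_pmf.prob (sbm n a b \<sigma>) (envelope n C a)"
    and sep: "40 * ln (real n * real K) \<le> signal n K \<beta> a b"
    and priv: "c * \<epsilon> \<le> \<epsilon> / (4 * sensitivity n C a) / tstar n a b * (signal n K \<beta> a b / 20)"
    and eps: "4 / c * ln n \<le> \<epsilon>"
    and n: "(1 + exp 1 * fact K)\<^sup>2 \<le> real n"
  shows "risk n K a b M \<sigma> \<le> exp (- (1 / 80) * signal n K \<beta> a b) + exp (- (c / 4) * \<epsilon>)"
proof -
  define F :: real where "F = exp 1 * fact K"
  define s where "s = signal n K \<beta> a b"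
  define y where "y = min 1 (\<epsilon> / (4 * sensitivity n C a) / tstar n a b) * (s / 20)"
  have n0: "2 \<le> n" using K by simp
  have F: "F > 0" by (simp add: F_def)
  have lnn: "0 \<le> ln n" using n0 by simp
  \<comment> \<open>The largeness of \<open>n\<close> makes the constant \<open>F\<close> cost at
    most half of \<open>ln n\<close> in the exponent.\<close>
  have lnF: "2 * ln (1 + F) \<le> ln n"
  proof -
    have "2 * ln (1 + F) = ln ((1 + F)\<^sup>2)" using F by (simp add: ln_realpow)
    also have "\<dots> \<le> ln n" using n F unfolding F_def by (intro ln_mono zero_less_power add_pos_pos) auto
    finally show ?thesis .
  qed
  have lnK: "ln n \<le> ln (real n * real K)" "ln (real n * real K) \<le> 2 * ln n"
    using K n0 by (auto simp: ln_mult)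
  have eps': "4 * ln n \<le> c * \<epsilon>" using eps c by (simp add: field_simps)
  then have eps0: "0 \<le> \<epsilon>" using lnn c by (smt (verit) zero_le_mult_iff)
  have s0: "40 * ln n \<le> s" using sep lnK by (simp add: s_def)
  have y_eq: "y = min (s / 20) (\<epsilon> / (4 * sensitivity n C a) / tstar n a b * (s / 20))"
    using s0 lnn by (simp add: y_def min_mult_distrib_right)
  have y: "min (s / 20) (c * \<epsilon>) \<le> y"
    unfolding y_eq using priv[folded s_def] by (intro min.mono order_refl)
  moreover have "2 * ln (real n * real K) \<le> s / 20" using sep by (simp add: s_def)
  moreover have "2 * ln (real n * real K) \<le> c * \<epsilon>" using eps' lnK by simp
  \<comment> \<open>This is what the union bound requires. The signal side uses the separation
    constant 40, the privacy side \<open>K \<le> n\<close> and the factor 4 in the lower bound on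
    \<open>\<epsilon>\<close>.\<close>
  ultimately have y2: "2 * ln (real n * real K) \<le> y" by linarith
  have "real n * K * exp (- (y / 2)) \<le> real n * K * exp (- ln (real n * real K))"
    using y2 by (intro mult_left_mono) auto
  also have "\<dots> = 1"
  proof -
    have nK: "0 < real n * K" using n0 K by simp
    show ?thesis unfolding exp_minus exp_ln[OF nK] by (rule right_inverse[OF less_imp_neq[OF nK, symmetric]])
  qed
  finally have union: "real n * K * exp (- (y / 2)) \<le> 1" .
  have "risk n K a b M \<sigma> \<le> 1 - measure_pmf.prob (sbm n a b \<sigma>) (envelope n C a) + fact K * exp (1 - y / 2)"
    unfolding y_def s_def
    by (rule risk_le_chernoff[OF M assms(2) beta K(1) w _ ab(1,2) _ eps0 C])
       (use n0 ab union y2 lnK lnn in \<open>auto simp: y_def s_def\<close>)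
  moreover have "fact K * exp (1 - y / 2) = F * exp (- y / 2)"
    by (simp add: F_def mult.assoc mult.left_commute[of "exp 1"] flip: exp_add)
  ultimately have "risk n K a b M \<sigma> \<le> exp (- 10 * (a + ln n)) + F * exp (- y / 2)"
    using env by linarith
  also have "s \<le> 2 * a" unfolding s_def using ab beta(1) K(1) by (intro signal_le) auto
  then have "- 10 * (a + ln n) \<le> - 5 * s" using lnn by argo
  then have "exp (- 10 * (a + ln n)) \<le> exp (- 5 * s)" by simp
  finally have main: "risk n K a b M \<sigma> \<le> exp (- 5 * s) + F * exp (- y / 2)" by simp
  show ?thesis
  proof (cases "s / 20 \<le> y")
    case True
    have "exp (- 5 * s) \<le> exp (- s / 40)" using s0 lnn by simp
    moreover have "F * exp (- y / 2) \<le> F * exp (- s / 40)" using True F by simp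
    ultimately have "risk n K a b M \<sigma> \<le> (1 + F) * exp (- s / 40)" using main unfolding distrib_right mult_1_left by linarith
    also have "\<dots> = exp (ln (1 + F) + - s / 40)" using F by (simp only: exp_add exp_ln add_pos_pos zero_less_one)
    \<comment> \<open>Since \<open>ln (1 + F)\<close> is at most \<open>ln n / 2\<close>, hence at
      most \<open>s / 80\<close>, half of the exponent \<open>s / 40\<close> survives.\<close>
    also have "\<dots> \<le> exp (- (1 / 80) * s)" using lnF s0 by simp
    finally show ?thesis by (simp add: s_def add_increasing2)
  next
    case False
    then have y: "c * \<epsilon> \<le> y" using y by simp
    have "ln F \<le> ln (1 + F)" using F by simp
    have "F * exp (- y / 2) = exp (ln F + - y / 2)" using F by (simp only: exp_add exp_ln)
    \<comment> \<open>Here \<open>ln F\<close> is at most \<open>c * \<epsilon> / 8\<close> while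
      \<open>y / 2\<close> is at least \<open>c * \<epsilon> / 2\<close>.\<close>
    also have "\<dots> \<le> exp (- (c / 4) * \<epsilon>)" using \<open>ln F \<le> ln (1 + F)\<close> lnF lnn eps' y by simp
    finally have "F * exp (- y / 2) \<le> exp (- (c / 4) * \<epsilon>)" .
    moreover have "exp (- 5 * s) \<le> exp (- (1 / 80) * s)" using s0 lnn by simp
    ultimately show ?thesis using main unfolding s_def[symmetric] by linarith
  qed
qed

theorem corollary3p7:
  "\<exists>C\<^sub>0>0. \<forall>C\<^sub>s\<ge>C\<^sub>0.
     \<forall>(\<beta>::real) (\<rho>\<^sub>m::real) (\<rho>\<^sub>p::real) (K\<^sub>m\<^sub>a\<^sub>x::nat) (c\<^sub>a::real) (w::real) (C::real).
       0 < \<rho>\<^sub>m \<and> \<rho>\<^sub>m \<le> \<rho>\<^sub>p \<and> \<rho>\<^sub>p < 1 \<and> c\<^sub>a > 0 \<and> 0 \<le> w \<and> w \<le> 1 \<and> C > 0 \<longrightarrow>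
       (\<exists>L>0. \<exists>c_sig>0. \<exists>c_priv>0.
          \<forall>(K::nat \<Rightarrow> nat) (a::nat \<Rightarrow> real) (b::nat \<Rightarrow> real).
            sbm_params \<beta> K a b \<and>
            constant_snr \<rho>\<^sub>m \<rho>\<^sub>p a b \<and>
            envelope_whp C \<beta> K a b \<and>
            signal_entropy_separation C\<^sub>s \<beta> K a b \<and>
            mild_growth K \<and>
            a \<in> o(\<lambda>n. real n) \<and> b \<in> o(\<lambda>n. real n) \<and>
            (\<forall>\<^sub>F n in sequentially. a n \<ge> c\<^sub>a * ln (real n)) \<and>
            (\<forall>\<^sub>F n in sequentially. K n \<le> K\<^sub>m\<^sub>a\<^sub>x) \<longrightarrow>
            (\<forall>\<^sub>F n in sequentially. \<forall>(\<epsilon>::real) (M::graph \<Rightarrow> labelling pmf).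
               private_estimator n (K n) \<beta> w C (a n) (b n) \<epsilon> M \<and> \<epsilon> \<ge> L * ln (real n) \<longrightarrow>
               (SUP \<sigma>\<^sub>0\<in>Sigma_bal n (K n) \<beta>. risk n (K n) (a n) (b n) M \<sigma>\<^sub>0)
                 \<le> exp (- c_sig * signal n (K n) \<beta> (a n) (b n)) + exp (- c_priv * \<epsilon>)))"
proof (rule exI[of _ "40::real"], rule conjI[rotated], intro allI impI)
  \<comment> \<open>The threshold 40 for the separation constant makes \<open>signal / 20\<close> at
    least \<open>2 * ln (n * K)\<close>.\<close>
  fix C\<^sub>s \<beta> \<rho>\<^sub>m \<rho>\<^sub>p :: real and K\<^sub>m\<^sub>a\<^sub>x :: nat and c\<^sub>a w C :: real
  assume Cs: "40 \<le> C\<^sub>s"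
    and H: "0 < \<rho>\<^sub>m \<and> \<rho>\<^sub>m \<le> \<rho>\<^sub>p \<and> \<rho>\<^sub>p < 1 \<and> c\<^sub>a > 0 \<and> 0 \<le> w \<and> w \<le> 1 \<and> C > 0"
  \<comment> \<open>A lower bound for signal over \<open>a\<close>. The maximum and the added 1 keep
    the denominator positive, since \<open>1 \<le> \<beta>\<close> and the bounds on
    \<open>K\<close> become available only after the constants are chosen.\<close>
  define \<kappa> where "\<kappa> = (1 - sqrt \<rho>\<^sub>p)\<^sup>2 / (max 1 \<beta> * (K\<^sub>m\<^sub>a\<^sub>x + 1))"
  define T where "T = 1 / 2 * ln (2 / \<rho>\<^sub>m)"
  \<comment> \<open>Chosen so that \<open>max a (ln n)\<close> is at most \<open>m * a\<close> once
    \<open>a\<close> is at least \<open>c\<^sub>a * ln n\<close>.\<close>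
  define m where "m = max 1 (1 / c\<^sub>a)"
  \<comment> \<open>The constant 160 is 4 from the mechanism, 2 from the sensitivity and 20 from the
    Chernoff exponent; \<open>T\<close> bounds the tilt.\<close>
  define c where "c = \<kappa> / (160 * C * m * T)"
  have T: "T > 0" using H by (simp add: T_def)
  have m: "m > 0" by (simp add: m_def)
  have \<kappa>: "\<kappa> > 0" using H by (auto simp: \<kappa>_def intro!: divide_pos_pos mult_pos_pos)
  have c: "c > 0" using \<kappa> T m H by (simp add: c_def)
  show "\<exists>L>0. \<exists>c_sig>0. \<exists>c_priv>0.
          \<forall>(K::nat \<Rightarrow> nat) (a::nat \<Rightarrow> real) (b::nat \<Rightarrow> real).
            sbm_params \<beta> K a b \<and>
            constant_snr \<rho>\<^sub>m \<rho>\<^sub>p a b \<and>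
            envelope_whp C \<beta> K a b \<and>
            signal_entropy_separation C\<^sub>s \<beta> K a b \<and>
            mild_growth K \<and>
            a \<in> o(\<lambda>n. real n) \<and> b \<in> o(\<lambda>n. real n) \<and>
            (\<forall>\<^sub>F n in sequentially. a n \<ge> c\<^sub>a * ln (real n)) \<and>
            (\<forall>\<^sub>F n in sequentially. K n \<le> K\<^sub>m\<^sub>a\<^sub>x) \<longrightarrow>
            (\<forall>\<^sub>F n in sequentially. \<forall>(\<epsilon>::real) (M::graph \<Rightarrow> labelling pmf).
               private_estimator n (K n) \<beta> w C (a n) (b n) \<epsilon> M \<and> \<epsilon> \<ge> L * ln (real n) \<longrightarrow>
               (SUP \<sigma>\<^sub>0\<in>Sigma_bal n (K n) \<beta>. risk n (K n) (a n) (b n) M \<sigma>\<^sub>0)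
                 \<le> exp (- c_sig * signal n (K n) \<beta> (a n) (b n)) + exp (- c_priv * \<epsilon>))"
  proof (rule exI[of _ "4 / c"], rule conjI[rotated], rule exI[of _ "1 / 80"], rule conjI[rotated],
      rule exI[of _ "c / 4"], rule conjI[rotated], intro allI impI)
    fix K :: "nat \<Rightarrow> nat" and a b :: "nat \<Rightarrow> real"
    assume A: "sbm_params \<beta> K a b \<and>
            constant_snr \<rho>\<^sub>m \<rho>\<^sub>p a b \<and>
            envelope_whp C \<beta> K a b \<and>
            signal_entropy_separation C\<^sub>s \<beta> K a b \<and>
            mild_growth K \<and>
            a \<in> o(\<lambda>n. real n) \<and> b \<in> o(\<lambda>n. real n) \<and>
            (\<forall>\<^sub>F n in sequentially. a n \<ge> c\<^sub>a * ln (real n)) \<and>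
            (\<forall>\<^sub>F n in sequentially. K n \<le> K\<^sub>m\<^sub>a\<^sub>x)"
    have beta: "1 \<le> \<beta>" using A by (simp add: sbm_params_def)
    have snr: "\<forall>\<^sub>F n in sequentially. \<rho>\<^sub>m \<le> b n / a n \<and> b n / a n \<le> \<rho>\<^sub>p"
      using A by (simp add: constant_snr_def)
    have sep: "\<forall>\<^sub>F n in sequentially. signal n (K n) \<beta> (a n) (b n) \<ge> C\<^sub>s * ln (real n * real (K n))"
      using A by (simp add: signal_entropy_separation_def)
    have "\<forall>\<^sub>F n in sequentially. norm (a n) \<le> 1 / 2 * norm (real n)"
      using A by (intro landau_o.smallD) auto
    then have half: "\<forall>\<^sub>F n in sequentially. a n \<le> real n / 2"
      by eventually_elim auto
    \<comment> \<open>These thresholds give \<open>K n \<le> n\<close> and absorb the factorial of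
      the bounded number of clusters.\<close>
    have large: "\<forall>\<^sub>F n in sequentially. n \<ge> max 2 (max K\<^sub>m\<^sub>a\<^sub>x (nat \<lceil>(1 + exp 1 * fact K\<^sub>m\<^sub>a\<^sub>x :: real)\<^sup>2\<rceil>))"
      by (rule eventually_ge_at_top)
    have alog: "\<forall>\<^sub>F n in sequentially. a n \<ge> c\<^sub>a * ln (real n)"
      and Kmax: "\<forall>\<^sub>F n in sequentially. K n \<le> K\<^sub>m\<^sub>a\<^sub>x" using A by auto
    show "\<forall>\<^sub>F n in sequentially. \<forall>(\<epsilon>::real) (M::graph \<Rightarrow> labelling pmf).
               private_estimator n (K n) \<beta> w C (a n) (b n) \<epsilon> M \<and> \<epsilon> \<ge> 4 / c * ln (real n) \<longrightarrow>
               (SUP \<sigma>\<^sub>0\<in>Sigma_bal n (K n) \<beta>. risk n (K n) (a n) (b n) M \<sigma>\<^sub>0)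
                 \<le> exp (- (1 / 80) * signal n (K n) \<beta> (a n) (b n)) + exp (- (c / 4) * \<epsilon>)"
      using snr sep half large alog Kmax
    proof eventually_elim
      case (elim n)
      have n: "2 \<le> n" "K\<^sub>m\<^sub>a\<^sub>x \<le> n" "(1 + exp 1 * fact K\<^sub>m\<^sub>a\<^sub>x :: real)\<^sup>2 \<le> real n"
        using elim(4) by (auto simp: nat_le_iff ceiling_le_iff)
      have K: "2 \<le> K n" "3 \<le> K n \<Longrightarrow> \<beta> < sqrt (5 / 3)" and ab0: "a n < n" "b n < a n" "0 \<le> b n"
        using A n(1) by (auto simp: sbm_params_def)
      have a0: "0 < a n" using ab0 by simp
      have ratio: "\<rho>\<^sub>m * a n \<le> b n" "b n \<le> \<rho>\<^sub>p * a n" using elim(1) a0 by (auto simp: field_simps)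
      have b0: "0 < b n" using ratio(1) a0 H by (smt (verit) mult_pos_pos)
      define s where "s = signal n (K n) \<beta> (a n) (b n)"
      have lnK: "0 \<le> ln (real n * real (K n))" using n(1) K(1) by (simp add: ln_mult)
      have sep': "40 * ln (real n * real (K n)) \<le> s"
        using elim(2) mult_right_mono[OF Cs lnK] by (simp add: s_def)
      have s_ge: "a n * \<kappa> \<le> s"
        using signal_ge[of "b n" "a n" n \<rho>\<^sub>p \<beta> "K n" "K\<^sub>m\<^sub>a\<^sub>x + 1"] ab0 ratio H beta K elim(6)
        by (simp add: s_def \<kappa>_def max_absorb2)
      have t: "0 < tstar n (a n) (b n)" "tstar n (a n) (b n) \<le> T"
        using tstar_pos[of "b n" "a n" n] tstar_le[of "b n" "a n" n \<rho>\<^sub>m] ab0 b0 ratio H elim(3)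
        by (auto simp: T_def)
      have "ln n \<le> a n / c\<^sub>a" using elim(5) H by (simp add: field_simps)
      moreover have "1 * a n \<le> m * a n" "1 / c\<^sub>a * a n \<le> m * a n"
        unfolding m_def using a0 by (intro mult_right_mono max.cobounded1 max.cobounded2, simp)+
      ultimately have mx: "max (a n) (ln n) \<le> m * a n" by simp
      have sens: "0 < sensitivity n C (a n)" "sensitivity n C (a n) \<le> 2 * C * (m * a n)"
        using H a0 mx by (auto simp: sensitivity_def)
      have Fn: "(1 + exp 1 * fact (K n) :: real)\<^sup>2 \<le> real n"
      proof -
        have "(fact (K n) :: real) \<le> fact K\<^sub>m\<^sub>a\<^sub>x" using elim(6) by (rule fact_mono)
        then have "(1 + exp 1 * fact (K n) :: real)\<^sup>2 \<le> (1 + exp 1 * fact K\<^sub>m\<^sub>a\<^sub>x)\<^sup>2"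
          by (intro power_mono add_left_mono mult_left_mono) auto
        also note n(3)
        finally show ?thesis .
      qed
      show ?case
      proof (intro allI impI, elim conjE)
        fix \<epsilon> :: real and M :: "graph \<Rightarrow> labelling pmf"
        assume M: "private_estimator n (K n) \<beta> w C (a n) (b n) \<epsilon> M" and eps: "4 / c * ln (real n) \<le> \<epsilon>"
        have "0 \<le> 4 / c * ln (real n)" using c n(1) by simp
        with eps have eps0: "0 \<le> \<epsilon>" by simp
        \<comment> \<open>The factor \<open>a n\<close> cancels between the bound on the sensitivity
          and the bound on the signal.\<close>
        have "c * \<epsilon> = \<epsilon> / (4 * (2 * C * (m * a n)) * T) * (a n * \<kappa> / 20)"
          using a0 H m T by (simp add: c_def field_simps)
        also have "\<dots> \<le> \<epsilon> / (4 * sensitivity n C (a n) * tstar n (a n) (b n)) * (s / 20)"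
          using eps0 sens t s_ge a0 \<kappa> T H m
          by (intro mult_mono divide_left_mono divide_right_mono mult_pos_pos) auto
        finally have priv: "c * \<epsilon> \<le> \<epsilon> / (4 * sensitivity n C (a n)) / tstar n (a n) (b n) * (signal n (K n) \<beta> (a n) (b n) / 20)"
          by (simp add: s_def)
        \<comment> \<open>The supremum needs a nonempty index set: on the empty graph the mechanism
          must output some balanced labelling.\<close>
        have "(\<lambda>_ _. False) \<in> graphs n" by (simp add: graphs_def)
        then have "set_pmf (M (\<lambda>_ _. False)) \<subseteq> Sigma_bal n (K n) \<beta>"
          using M unfolding private_estimator_def by blast
        then have "Sigma_bal n (K n) \<beta> \<noteq> {}" using set_pmf_not_empty by fastforce
        then show "(SUP \<sigma>\<^sub>0\<in>Sigma_bal n (K n) \<beta>. risk n (K n) (a n) (b n) M \<sigma>\<^sub>0)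
            \<le> exp (- (1 / 80) * signal n (K n) \<beta> (a n) (b n)) + exp (- (c / 4) * \<epsilon>)"
        proof (rule cSUP_least)
          fix \<sigma> assume \<sigma>: "\<sigma> \<in> Sigma_bal n (K n) \<beta>"
          have env: "1 - exp (- 10 * (a n + ln n)) \<le> measure_pmf.prob (sbm n (a n) (b n) \<sigma>) (envelope n C (a n))"
            using A n(1) \<sigma> by (auto simp: envelope_whp_def)
          show "risk n (K n) (a n) (b n) M \<sigma>
              \<le> exp (- (1 / 80) * signal n (K n) \<beta> (a n) (b n)) + exp (- (c / 4) * \<epsilon>)"
            by (rule risk_le_exp_signal_add_exp_eps[OF M \<sigma> beta K(2) K(1) _ _ _ b0 ab0(2) elim(3) _ c env _ priv eps Fn])
               (use H elim(6) n(2) sep' in \<open>auto simp: s_def\<close>)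
        qed
      qed
    qed
  qed (use c in auto)
qed auto

end
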